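(* Let $\Omega\subset\mathbb{R}^n$ be the open unit ball, let $k$ be the Green's function of $-\Delta$ in $\Omega$ with homogeneous Dirichlet boundary conditions, and let $f,g:\overline{\Omega}\times[0,+\infty)\times[0,+\infty)\to[0,+\infty)$ be continuous. Let $r_1,r_2>0$ and suppose that there exist two continuous functions $\underline{f},\underline{g}:\overline{\Omega}\to[0,+\infty)$ such that: (a) $f(x,u,v)\ge \underline{f}(x)$ for all $(x,u,v)\in\overline{\Omega}\times[0,r_1]\times[0,r_2]$, and $$\sup_{x\in\overline{\Omega}}\int_{\Omega}k(x,y)\,\underline{f}(y)\,dy>0;$$ (b) $g(x,u,v)\ge \underline{g}(x)$ for all $(x,u,v)\in\overline{\Omega}\times[0,r_1]\times[0,r_2]$, and $$\sup_{x\in\overline{\Omega}}\int_{\Omega}k(x,y)\,\underline{g}(y)\,dy>0.$$ Then there exist $\lambda_1,\lambda_2>0$ and $(u_0,v_0)\in P\times P$ with $\|u_0\|_\infty=r_1$ and $\|v_0\|_\infty=r_2$ such that, for all $x\in\overline{\Omega}$, $$u_0(x)=\lambda_1\int_{\Omega}k(x,y)\,f(y,u_0(y),v_0(y))\,dy,\qquad v_0(x)=\lambda_2\int_{\Omega}k(x,y)\,g(y,u_0(y),v_0(y))\,dy.$$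
   Context: $\mathcal{C}(\overline{\Omega})$ is the space of real continuous functions on $\overline{\Omega}$ with the norm $\|u\|_\infty=\max_{x\in\overline{\Omega}}|u(x)|$, and $P=\{u\in\mathcal{C}(\overline{\Omega}):u\ge 0\}$. The Green's function $k$ is normalized so that, for sufficiently smooth $h$, the function $w(x)=\int_\Omega k(x,y)h(y)\,dy$ is the unique solution of $-\Delta w=h$ in $\Omega$, $w=0$ on $\partial\Omega$; it is non-negative, continuous for $x\ne y$ and singular on the diagonal. A pair $(u_0,v_0)$ satisfying the integral system in the conclusion is what is called a (weak) solution of the problem $-\Delta u=\lambda_1 f(x,u,v)$, $-\Delta v=\lambda_2 g(x,u,v)$ in $\Omega$, $u=v=0$ on $\partial\Omega$. *)

theory Defs
  imports "HOL-Analysis.Analysis"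
begin

definition partial_deriv :: "'a::euclidean_space \<Rightarrow> ('a \<Rightarrow> real) \<Rightarrow> 'a \<Rightarrow> real" where
  "partial_deriv b u x = frechet_derivative u (at x) b"

definition laplacian :: "('a::euclidean_space \<Rightarrow> real) \<Rightarrow> 'a \<Rightarrow> real" where
  "laplacian u x = (\<Sum>b\<in>Basis. partial_deriv b (partial_deriv b u) x)"

definition C2_on :: "'a::euclidean_space set \<Rightarrow> ('a \<Rightarrow> real) \<Rightarrow> bool" where
  "C2_on S u \<longleftrightarrow>
     (\<forall>x\<in>S. u differentiable (at x)) \<and>
     (\<forall>b\<in>Basis. \<forall>x\<in>S. partial_deriv b u differentiable (at x)) \<and>
     (\<forall>b\<in>Basis. \<forall>c\<in>Basis. continuous_on S (partial_deriv c (partial_deriv b u)))"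

definition harmonic_on :: "'a::euclidean_space set \<Rightarrow> ('a \<Rightarrow> real) \<Rightarrow> bool" where
  "harmonic_on S u \<longleftrightarrow> C2_on S u \<and> (\<forall>x\<in>S. laplacian u x = 0)"

text \<open>
  The fundamental solution of \<open>-\<Delta>\<close> (the distributional Laplacian of its negative is the Dirac
  measure at the origin).  For dimension one the second branch is \<open>-\<bar>z\<bar> / 2\<close>.
\<close>
definition fundamental_solution :: "'a::euclidean_space \<Rightarrow> real" where
  "fundamental_solution z =
     (let n = real DIM('a) in
      if DIM('a) = 2 then - ln (norm z) / (2 * pi)
      else norm z powr (2 - n) / (n * (n - 2) * unit_ball_vol n))"

text \<open>
  \<open>k\<close> is the Green's function of \<open>-\<Delta>\<close> in \<open>\<Omega>\<close> with homogeneous Dirichlet boundary conditions: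
  for every pole \<open>y\<close> in \<open>\<Omega>\<close>, \<open>k(\<cdot>, y)\<close> is the fundamental solution centred at \<open>y\<close>, minus the
  corrector \<open>\<phi>\<close> that is harmonic in \<open>\<Omega>\<close> and has the same boundary values.  In particular
  \<open>k(x, y) = 0\<close> for \<open>x\<close> on the boundary.  The value at \<open>x = y\<close> is left unspecified.
\<close>
definition dirichlet_green_function ::
    "'a::euclidean_space set \<Rightarrow> ('a \<Rightarrow> 'a \<Rightarrow> real) \<Rightarrow> bool" where
  "dirichlet_green_function \<Omega> k \<longleftrightarrow>
     (\<forall>y\<in>\<Omega>. \<exists>\<phi>. continuous_on (closure \<Omega>) \<phi> \<and> harmonic_on \<Omega> \<phi> \<and>
        (\<forall>x\<in>frontier \<Omega>. \<phi> x = fundamental_solution (x - y)) \<and>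
        (\<forall>x\<in>closure \<Omega> - {y}. k x y = fundamental_solution (x - y) - \<phi> x))"

text \<open>
  Elements of \<open>C(K)\<close> are represented by functions on the whole space, of which only the values
  on \<open>K\<close> matter.
\<close>
definition nonneg_cone :: "'a::topological_space set \<Rightarrow> ('a \<Rightarrow> real) set" where
  "nonneg_cone K = {u. continuous_on K u \<and> (\<forall>x\<in>K. 0 \<le> u x)}"

definition max_norm :: "'a set \<Rightarrow> ('a \<Rightarrow> real) \<Rightarrow> real" where
  "max_norm K u = (SUP x\<in>K. \<bar>u x\<bar>)"

end

theory Submission
  imports Defs "HOL-Complex_Analysis.Great_Picard"
begin

text \<open>
  By the maximum principle the Green's function of the unit ball is the classical one obtained by
  reflection in the sphere.  It is nonnegative and bounded by an integrable function of \<open>x - y\<close>, so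
  \<open>h \<mapsto> \<integral> k(x, y) h(y) dy\<close> is a compact operator on continuous functions.  Write \<open>A(u, v)\<close> and
  \<open>B(u, v)\<close> for the two right-hand sides without the factors \<open>\<lambda>\<^sub>1\<close>, \<open>\<lambda>\<^sub>2\<close>.  The lower bounds on \<open>f\<close> and
  \<open>g\<close> keep \<open>\<parallel>A\<parallel>\<close> and \<open>\<parallel>B\<parallel>\<close> away from zero on the convex set \<open>0 \<le> u \<le> r\<^sub>1\<close>, \<open>0 \<le> v \<le> r\<^sub>2\<close>, so that
  \<open>(u, v) \<mapsto> (r\<^sub>1 A / \<parallel>A\<parallel>, r\<^sub>2 B / \<parallel>B\<parallel>)\<close> is a compact self-map of it.  A fixed point, given by
  Schauder's theorem, is a solution with \<open>\<lambda>\<^sub>1 = r\<^sub>1 / \<parallel>A\<parallel>\<close> and \<open>\<lambda>\<^sub>2 = r\<^sub>2 / \<parallel>B\<parallel>\<close>.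
\<close>

section \<open>Schauder's fixed point theorem\<close>

text \<open>Schauder's theorem is stated for a normed space given as a type, and a closed ball is
  not a type. Continuous functions on the ball are therefore modelled inside the bounded continuous
  functions on the whole space: they are extended by precomposition with the nearest-point
  projection, which changes neither range nor sup norm. All operators return functions of this
  shape, so a fixed point is determined by its values on the ball.

  The main obstacle is the diagonal. There the kernel is singular and the given \<open>k\<close> is
  unspecified, and its bound has a singularity that moves with \<open>x\<close>. Compactness thus
  rests on continuity of \<open>x \<mapsto> k x\<close> in the L1 norm, which controls potentials
  uniformly over bounded densities. Dividing each component by its own norm is what allows both
  norms to be prescribed; the factors are read off afterwards.\<close>

text \<open>Points of the cube are functions on \<open>nat\<close> because the dimension, which will be the size of a
  finite net, varies inside a proof and so cannot be a type.\<close>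
lemma brouwer_cube_approx:
  fixes G :: "(nat \<Rightarrow> real) \<Rightarrow> nat \<Rightarrow> real"
  assumes range: "\<And>t i. \<lbrakk>\<And>j. j < n \<Longrightarrow> t j \<in> {0..1}; i < n\<rbrakk> \<Longrightarrow> G t i \<in> {0..1}"
    and uc: "\<And>e. 0 < e \<Longrightarrow> \<exists>d>0. \<forall>s t. (\<forall>j<n. s j \<in> {0..1} \<and> t j \<in> {0..1} \<and> \<bar>s j - t j\<bar> \<le> d) \<longrightarrow>
                 (\<forall>i<n. \<bar>G s i - G t i\<bar> < e)"
    and "0 < e"
  obtains t where "\<And>i. i < n \<Longrightarrow> t i \<in> {0..1}" "\<And>i. i < n \<Longrightarrow> \<bar>G t i - t i\<bar> < e"
proof -
  obtain d where d: "d > 0" and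
    dG: "\<And>s t i. \<lbrakk>\<And>j. j < n \<Longrightarrow> s j \<in> {0..1} \<and> t j \<in> {0..1} \<and> \<bar>s j - t j\<bar> \<le> d; i < n\<rbrakk> \<Longrightarrow> \<bar>G s i - G t i\<bar> < e/2"
    using uc[of "e/2"] \<open>0 < e\<close> by (meson half_gt_zero)
  obtain p0 where p0: "inverse (real (Suc p0)) < min d (e/2)"
    using reals_Archimedean[of "min d (e/2)"] d \<open>0 < e\<close> by auto
  define p where "p = Suc p0"
  have p: "0 < p" by (simp add: p_def)
  have "1 / real p = inverse (real (Suc p0))" by (simp only: p_def divide_inverse mult_1)
  then have pd: "1 / p \<le> d" and pe: "1 / p \<le> e/2"
    using p0 by linarith+
  define sc where "sc = (\<lambda>x :: nat \<Rightarrow> nat. \<lambda>i. real (x i) / p)"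
  \<comment> \<open>The clause \<open>x i = p\<close> forces the label 1 that Kuhn's lemma demands
    on the upper faces, where \<open>G\<close> may equal 1; label 0 on the lower faces is automatic
    because \<open>G\<close> is nonnegative.\<close>
  define label where "label x i = (if x i = p \<or> G (sc x) i < sc x i then 1 else (0::nat))" for x i
  have sc01: "sc x i \<in> {0..1}" if "x i \<le> p" for x i
    using that p by (auto simp: sc_def divide_simps)
  have G01: "G (sc x) i \<in> {0..1}" if "\<forall>j<n. x j \<le> p" "i < n" for x i
    using range sc01 that by blast
  have lab0: "sc x i \<le> G (sc x) i" if "label x i = 0" for x i
    using that by (auto simp: label_def split: if_splits)
  have lab1: "G (sc x) i \<le> sc x i" if "label x i \<noteq> 0" "\<forall>j<n. x j \<le> p" "i < n" for x i
    using that G01[of x i] p by (auto simp: label_def sc_def split: if_splits)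
  have L0: "label x i = 0" if "\<forall>j<n. x j \<le> p" "i < n" "x i = 0" for x i
    using that G01[of x i] p by (auto simp: label_def sc_def)
  have L1: "label x i = 1" if "x i = p" for x i
    using that by (auto simp: label_def)
  have L: "label x i = 0 \<or> label x i = 1" for x i
    by (auto simp: label_def)
  obtain q where q: "\<forall>i<n. q i < p"
    and qrs: "\<forall>i<n. \<exists>r s. (\<forall>j<n. q j \<le> r j \<and> r j \<le> q j + 1) \<and>
               (\<forall>j<n. q j \<le> s j \<and> s j \<le> q j + 1) \<and> label r i \<noteq> label s i"
    using kuhn_lemma[of p n label] p L L0 L1 by blast
  have near: "\<bar>G (sc q) i - G (sc r) i\<bar> < e/2" "sc q i \<le> sc r i" "sc r i \<le> sc q i + e/2" "\<forall>j<n. r j \<le> p"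
    if r: "\<forall>j<n. q j \<le> r j \<and> r j \<le> q j + 1" and i: "i < n" for r i
  proof -
    show rp: "\<forall>j<n. r j \<le> p" using r q by (metis Suc_leI le_trans Suc_eq_plus1)
    have *: "sc q j \<le> sc r j \<and> sc r j \<le> sc q j + 1/p" if "j < n" for j
    proof -
      have "real (q j) \<le> real (r j)" "real (r j) \<le> real (q j) + 1"
        using r that by (auto simp flip: of_nat_Suc simp del: of_nat_Suc)
      then show ?thesis using p by (auto simp: sc_def divide_simps)
    qed
    show "sc q i \<le> sc r i" "sc r i \<le> sc q i + e/2" using *[OF i] pe by auto
    show "\<bar>G (sc q) i - G (sc r) i\<bar> < e/2"
    proof (rule dG[OF _ i])
      fix j assume j: "j < n"
      show "sc q j \<in> {0..1} \<and> sc r j \<in> {0..1} \<and> \<bar>sc q j - sc r j\<bar> \<le> d"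
        using *[OF j] pd sc01[of q j] sc01[of r j] q rp j by (auto simp: less_imp_le)
    qed
  qed
  show ?thesis
  proof (rule that[of "sc q"])
    fix i assume i: "i < n"
    then show "sc q i \<in> {0..1}" using q sc01 less_imp_le by blast
    obtain r s where r: "\<forall>j<n. q j \<le> r j \<and> r j \<le> q j + 1"
      and s: "\<forall>j<n. q j \<le> s j \<and> s j \<le> q j + 1" and rs: "label r i \<noteq> label s i"
      using qrs i by blast
    have "\<exists>r s. (\<forall>j<n. q j \<le> r j \<and> r j \<le> q j + 1) \<and> (\<forall>j<n. q j \<le> s j \<and> s j \<le> q j + 1)
            \<and> label r i = 0 \<and> label s i \<noteq> 0"
    proof (cases "label r i = 0")
      case True with r s rs show ?thesis by metis
    next
      case False
      with L[of r i] L[of s i] rs have "label s i = 0" by auto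
      with r s False show ?thesis by metis
    qed
    then obtain r s where r: "\<forall>j<n. q j \<le> r j \<and> r j \<le> q j + 1"
      and s: "\<forall>j<n. q j \<le> s j \<and> s j \<le> q j + 1" and rs: "label r i = 0" "label s i \<noteq> 0"
      by blast
    \<comment> \<open>The vertex labelled 0 bounds \<open>G - id\<close> at \<open>q\<close> from
      below and the one labelled 1 from above; the loss is at most \<open>e/2\<close> for the
      oscillation of \<open>G\<close> and \<open>e/2\<close> for the mesh.\<close>
    show "\<bar>G (sc q) i - sc q i\<bar> < e"
      using near[OF r i] near[OF s i] lab0[OF rs(1)] lab1[OF rs(2) _ i] unfolding abs_real_def
      by (smt (verit) field_sum_of_halves)
  qed
qed

text \<open>The coefficients range over the whole cube: they are rescaled if their sum exceeds 1, and
  otherwise \<open>c0\<close> receives the missing mass.\<close>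
definition simplex_comb :: "'b::real_vector \<Rightarrow> nat \<Rightarrow> (nat \<Rightarrow> 'b) \<Rightarrow> (nat \<Rightarrow> real) \<Rightarrow> 'b" where
  "simplex_comb c0 n c t = c0 + (\<Sum>i<n. (t i / max 1 (\<Sum>j<n. t j)) *\<^sub>R (c i - c0))"

lemma simplex_comb_in_convex_hull:
  assumes t: "\<And>i. i < n \<Longrightarrow> 0 \<le> t i"
  shows "simplex_comb c0 n c t \<in> convex hull (insert c0 (c ` {..<n}))"
proof -
  define s where "s i = t i / max 1 (\<Sum>j<n. t j)" for i
  have s0: "0 \<le> s i" if "i < n" for i using t that by (simp add: s_def)
  have s1: "(\<Sum>i<n. s i) \<le> 1"
    by (simp add: s_def flip: sum_divide_distrib)
  \<comment> \<open>The extra index \<open>n\<close> carries \<open>c0\<close> with the missing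
    mass.\<close>
  define a where "a i = (if i < n then s i else 1 - (\<Sum>i<n. s i))" for i
  define y where "y i = (if i < n then c i else c0)" for i
  have "(\<Sum>i\<in>{..n}. a i *\<^sub>R y i) \<in> convex hull (insert c0 (c ` {..<n}))"
  proof (rule convex_sum)
    show "sum a {..n} = 1" by (simp add: a_def lessThan_Suc_atMost[symmetric])
    show "0 \<le> a i" if "i \<in> {..n}" for i using s0 s1 by (auto simp: a_def)
    show "y i \<in> convex hull insert c0 (c ` {..<n})" if "i \<in> {..n}" for i
      by (rule hull_inc) (auto simp: y_def)
  qed (auto)
  also have "(\<Sum>i\<in>{..n}. a i *\<^sub>R y i) = (\<Sum>i<n. s i *\<^sub>R c i) + (1 - (\<Sum>i<n. s i)) *\<^sub>R c0"
    by (simp add: a_def y_def lessThan_Suc_atMost[symmetric])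
  also have "\<dots> = simplex_comb c0 n c t"
    by (simp add: simplex_comb_def s_def[symmetric] scaleR_diff_right sum_subtractf scaleR_left_diff_distrib
        scaleR_sum_left)
  finally show ?thesis .
qed

text \<open>The normalising factor moves by at most \<open>n * d\<close> and never drops below 1, so
  a coefficient moves by at most \<open>d\<close> on its own account and \<open>n * d\<close>
  through the normalisation. This transfers an approximate fixed point in the coefficients to one in
  the space.\<close>

lemma norm_simplex_comb_diff_le:
  fixes c0 :: "'b::real_normed_vector"
  assumes s: "\<And>i. i < n \<Longrightarrow> 0 \<le> s i" and t: "\<And>i. i < n \<Longrightarrow> 0 \<le> t i"
    and d: "\<And>i. i < n \<Longrightarrow> \<bar>s i - t i\<bar> \<le> d"
  shows "norm (simplex_comb c0 n c s - simplex_comb c0 n c t) \<le> (real n + 1) * d * (\<Sum>i<n. norm (c i - c0))"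
proof -
  define ms where "ms = max 1 (\<Sum>j<n. s j)"
  define mt where "mt = max 1 (\<Sum>j<n. t j)"
  have m1: "1 \<le> ms" "1 \<le> mt" by (auto simp: ms_def mt_def)
  have "\<bar>(\<Sum>j<n. s j) - (\<Sum>j<n. t j)\<bar> \<le> (\<Sum>j<n. \<bar>s j - t j\<bar>)"
    by (simp flip: sum_subtractf)
  also have "\<dots> \<le> (\<Sum>j<n. d)" using d by (intro sum_mono) auto
  finally have mst: "\<bar>ms - mt\<bar> \<le> real n * d" by (auto simp: ms_def mt_def max_def)
  have tm: "t i \<le> mt" if "i < n" for i
  proof -
    have "t i \<le> (\<Sum>j<n. t j)" using that t by (intro member_le_sum) auto
    then show ?thesis by (simp add: mt_def)
  qed
  have coef: "\<bar>s i / ms - t i / mt\<bar> \<le> (real n + 1) * d" if i: "i < n" for i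
  proof -
    \<comment> \<open>Split so that only the quotient \<open>t i / mt\<close>, which is at most 1,
      and divisions by \<open>ms \<ge> 1\<close> occur.\<close>
    have "s i / ms - t i / mt = (s i - t i) / ms + (t i / mt) * ((mt - ms) / ms)"
      using m1 by (simp add: field_simps)
    also have "\<bar>\<dots>\<bar> \<le> \<bar>(s i - t i) / ms\<bar> + \<bar>t i / mt\<bar> * \<bar>(mt - ms) / ms\<bar>"
      by (metis abs_mult abs_triangle_ineq)
    also have "\<bar>t i / mt\<bar> * \<bar>(mt - ms) / ms\<bar> \<le> 1 * (real n * d)"
    proof (rule mult_mono)
      show "\<bar>t i / mt\<bar> \<le> 1" using t[OF i] tm[OF i] m1 by (simp)
      have "\<bar>(mt - ms) / ms\<bar> = \<bar>ms - mt\<bar> / ms" using m1 by (simp add: abs_minus_commute)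
      also have "\<dots> \<le> \<bar>ms - mt\<bar> / 1" using m1 by (intro divide_left_mono) auto
      finally show "\<bar>(mt - ms) / ms\<bar> \<le> real n * d" using mst by simp
    qed auto
    also have "\<bar>(s i - t i) / ms\<bar> = \<bar>s i - t i\<bar> / ms" using m1 by simp
    also have "\<dots> \<le> \<bar>s i - t i\<bar> / 1" using m1 by (intro divide_left_mono) auto
    also have "\<dots> \<le> d" using d[OF i] by simp
    finally show ?thesis by (simp add: algebra_simps)
  qed
  have "simplex_comb c0 n c s - simplex_comb c0 n c t = (\<Sum>i<n. (s i / ms - t i / mt) *\<^sub>R (c i - c0))"
    by (simp add: simplex_comb_def ms_def mt_def sum_subtractf scaleR_left_diff_distrib)
  also have "norm \<dots> \<le> (\<Sum>i<n. \<bar>s i / ms - t i / mt\<bar> * norm (c i - c0))"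
    by (rule order_trans[OF norm_sum]) simp
  also have "\<dots> \<le> (\<Sum>i<n. ((real n + 1) * d) * norm (c i - c0))"
    using coef by (intro sum_mono mult_right_mono) auto
  finally show ?thesis by (simp add: sum_distrib_left)
qed

lemma simplex_comb_sum_1:
  assumes "(\<Sum>i<n. t i) = 1"
  shows "simplex_comb c0 n c t = (\<Sum>i<n. t i *\<^sub>R c i)"
  using assms by (simp add: simplex_comb_def scaleR_diff_right sum_subtractf scaleR_sum_left[symmetric])

text \<open>The cube result is applied to coefficients: \<open>G\<close> sends \<open>t\<close> to
  the partition-of-unity weights of the point \<open>T (?U t)\<close>. At an approximate fixed point
  the weights recombine to a point within \<open>h\<close> of \<open>T u\<close>, and the Lipschitz
  bound on \<open>?U\<close> puts the same point within \<open>h\<close> of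
  \<open>u\<close>.\<close>

lemma schauder_approx:
  fixes T :: "'b::real_normed_vector \<Rightarrow> 'b"
  assumes S: "convex S" "S \<noteq> {}" and T: "continuous_on S T" "T ` S \<subseteq> C"
    and C: "compact C" "C \<subseteq> S" and e: "0 < e"
  obtains u where "u \<in> S" "norm (T u - u) < e"
proof -
  have TC: "T x \<in> C" if "x \<in> S" for x using T(2) that by (rule subsetD[OF _ imageI])
  define h where "h = e/2"
  have h: "0 < h" using e by (simp add: h_def)
  obtain c0 where c0: "c0 \<in> S" using S by auto
  obtain K where K: "finite K" "K \<subseteq> C" "C \<subseteq> (\<Union>x\<in>K. ball x h)"
    using compactE_image[OF C(1), of C "\<lambda>x. ball x h"] h by (metis (no_types, lifting) UN_I centre_in_ball open_ball subsetI)
  obtain c :: "nat \<Rightarrow> 'b" and n where c: "K = c ` {..<n}"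
    using finite_imp_nat_seg_image_inj_on[OF K(1)] by (auto simp: lessThan_def)
  \<comment> \<open>the partition of unity of the Schauder projection onto the net\<close>
  define w where "w i x = max 0 (h - dist x (c i))" for i x
  define p where "p i x = w i x / (\<Sum>j<n. w j x)" for i x
  have w0: "0 \<le> w i x" for i x by (simp add: w_def)
  have W: "0 < (\<Sum>j<n. w j x)" if x: "x \<in> C" for x
  proof -
    obtain i where i: "i < n" "dist x (c i) < h" using x K c by (auto simp: dist_commute)
    have "0 < w i x" using i by (simp add: w_def)
    also have "\<dots> \<le> (\<Sum>j<n. w j x)" using i w0 by (intro member_le_sum) auto
    finally show ?thesis .
  qed
  have p0: "0 \<le> p i x" for i x using w0 by (simp add: p_def sum_nonneg)
  have psum: "(\<Sum>i<n. p i x) = 1" if "x \<in> C" for x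
    using W[OF that] by (simp add: p_def flip: sum_divide_distrib)
  have p1: "p i x \<le> 1" if "x \<in> C" "i < n" for i x
  proof -
    have "p i x \<le> (\<Sum>i<n. p i x)" using that p0 by (intro member_le_sum) auto
    then show ?thesis using psum that by simp
  qed
  have pcont: "continuous_on C (p i)" for i
    unfolding p_def w_def using W unfolding w_def by (intro continuous_intros) (metis less_irrefl)
  define H where "H = convex hull (insert c0 K)"
  have H: "compact H"
    unfolding H_def using K(1) by (intro finite_imp_compact_convex_hull) simp
  have HS: "H \<subseteq> S"
    unfolding H_def using K(2) C(2) c0 S(1) by (intro hull_minimal) blast+
  let ?U = "simplex_comb c0 n c"
  have UH: "?U t \<in> H" if "\<And>i. i < n \<Longrightarrow> 0 \<le> t i" for t
    using simplex_comb_in_convex_hull[of n t c0 c] that by (simp add: H_def c)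
  \<comment> \<open>One more than the Lipschitz constant, so that division by \<open>L\<close> is
    possible even when that constant is 0.\<close>
  define L where "L = (real n + 1) * (\<Sum>i<n. norm (c i - c0)) + 1"
  have L: "L \<ge> 1" by (simp add: L_def sum_nonneg)
  have Udiff: "norm (?U s - ?U t) \<le> L * d"
    if "\<And>i. i < n \<Longrightarrow> 0 \<le> s i \<and> 0 \<le> t i \<and> \<bar>s i - t i\<bar> \<le> d" "0 \<le> d" for s t d
    using norm_simplex_comb_diff_le[of n s t d c0 c] that by (simp add: L_def algebra_simps)
  define G where "G t i = p i (T (?U t))" for t i
  have TU: "T (?U t) \<in> C" if "\<And>i. i < n \<Longrightarrow> 0 \<le> t i" for t
    by (rule TC, rule subsetD[OF HS], rule UH, rule that)
  have "\<exists>d>0. \<forall>s t. (\<forall>j<n. s j \<in> {0..1} \<and> t j \<in> {0..1} \<and> \<bar>s j - t j\<bar> \<le> d) \<longrightarrow>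
                 (\<forall>i<n. \<bar>G s i - G t i\<bar> < r)" if r: "0 < r" for r
  proof -
    have "\<exists>d>0. \<forall>x\<in>H. \<forall>y\<in>H. dist y x < d \<longrightarrow> dist (p i (T y)) (p i (T x)) < r" for i
    proof -
      have "continuous_on H (\<lambda>x. p i (T x))"
        by (rule continuous_on_compose2[OF pcont[of i] continuous_on_subset[OF T(1) HS]])
           (use HS TC in blast)
      then have "uniformly_continuous_on H (\<lambda>x. p i (T x))"
        using H compact_uniformly_continuous by blast
      then show ?thesis using r unfolding uniformly_continuous_on_def by blast
    qed
    then obtain D where D: "\<And>i. 0 < D i"
      "\<And>i x y. \<lbrakk>x \<in> H; y \<in> H; dist y x < D i\<rbrakk> \<Longrightarrow> dist (p i (T y)) (p i (T x)) < r"
      by metis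
    \<comment> \<open>Inserting 1 keeps the minimum meaningful for \<open>n = 0\<close>.\<close>
    define m where "m = Min (insert 1 (D ` {..<n}))"
    have m: "0 < m" "\<And>i. i < n \<Longrightarrow> m \<le> D i" using D(1) by (auto simp: m_def)
    show ?thesis
    \<comment> \<open>The factor 2 limits the displacement to \<open>m / 2\<close>, hence strictly
      below \<open>m\<close>.\<close>
    proof (intro exI[of _ "m / (2 * L)"] conjI allI impI)
      show "0 < m / (2 * L)" using m L by simp
      fix s t i assume st: "\<forall>j<n. s j \<in> {0..1} \<and> t j \<in> {0..1} \<and> \<bar>s j - t j\<bar> \<le> m / (2 * L)" and i: "i < n"
      have "norm (?U s - ?U t) \<le> L * (m / (2 * L))" using st m L by (intro Udiff) auto
      also have "\<dots> < m" using L m by simp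
      finally have "dist (?U s) (?U t) < D i" using m(2)[OF i] by (simp add: dist_norm)
      then show "\<bar>G s i - G t i\<bar> < r"
        using D(2)[of "?U t" "?U s" i] UH[of s] UH[of t] st by (auto simp: G_def dist_real_def)
    qed
  qed
  moreover have "G t i \<in> {0..1}" if "\<And>j. j < n \<Longrightarrow> t j \<in> {0..1}" "i < n" for t i
    using TU[of t] that p0 p1 by (auto simp: G_def)
  moreover have "0 < h / L" using h L by simp
  ultimately obtain t where t: "\<And>i. i < n \<Longrightarrow> t i \<in> {0..1}" "\<And>i. i < n \<Longrightarrow> \<bar>G t i - t i\<bar> < h / L"
    using brouwer_cube_approx[of n G "h / L"] by blast
  define u where "u = ?U t"
  define q where "q i = p i (T u)" for i
  have uH: "u \<in> H" using t UH by (auto simp: u_def)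
  have Tu: "T u \<in> C" by (rule TC, rule subsetD[OF HS uH])
  have "norm (?U q - ?U t) \<le> L * (h / L)"
    using t h L p0 by (intro Udiff) (auto simp: q_def G_def u_def less_imp_le)
  moreover have Uq: "?U q = (\<Sum>i<n. q i *\<^sub>R c i)"
    using psum[OF Tu] by (intro simplex_comb_sum_1) (simp add: q_def)
  moreover have "norm (T u - ?U q) < h"
  proof -
    have "T u - ?U q = (\<Sum>i<n. q i *\<^sub>R (T u - c i))"
      using psum[OF Tu] by (simp add: Uq scaleR_diff_right sum_subtractf scaleR_sum_left[symmetric] q_def)
    also have "norm \<dots> \<le> (\<Sum>i<n. q i * norm (T u - c i))"
      by (rule order_trans[OF norm_sum]) (simp add: q_def p0)
    \<comment> \<open>Only net points within \<open>h\<close> of \<open>T u\<close> carry weight;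
      strictness comes from a net point whose open ball contains \<open>T u\<close>.\<close>
    also have "\<dots> < (\<Sum>i<n. q i * h)"
    proof (rule sum_strict_mono_ex1)
      show "\<forall>i\<in>{..<n}. q i * norm (T u - c i) \<le> q i * h"
      proof
        fix i
        show "q i * norm (T u - c i) \<le> q i * h"
        proof (cases "norm (T u - c i) \<le> h")
          case False
          then have "q i = 0" by (simp add: q_def p_def w_def dist_norm)
          then show ?thesis by simp
        qed (simp add: q_def p0 mult_left_mono)
      qed
      obtain i where i: "i < n" "dist (T u) (c i) < h" using Tu K c by (auto simp: dist_commute)
      then have "0 < q i" using W[OF Tu] by (simp add: q_def p_def w_def)
      then show "\<exists>i\<in>{..<n}. q i * norm (T u - c i) < q i * h"
        using i by (intro bexI[of _ i]) (simp_all add: dist_norm)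
    qed auto
    also have "\<dots> = h" using psum[OF Tu] by (simp add: q_def flip: sum_distrib_right)
    finally show ?thesis .
  qed
  ultimately have "norm (T u - u) < h + h"
    using L norm_triangle_lt[of "T u - ?U q" "?U q - u" "h + h"] by (simp add: u_def)
  then show ?thesis using that uH HS by (auto simp: h_def)
qed

text \<open>Compactness of \<open>C\<close> makes the images of approximate fixed points converge
  along a subsequence. The points themselves have the same limit because the errors vanish, and
  closedness of \<open>S\<close> keeps it in \<open>S\<close>.\<close>

theorem schauder:
  fixes T :: "'b::real_normed_vector \<Rightarrow> 'b"
  assumes S: "convex S" "closed S" "S \<noteq> {}" and T: "continuous_on S T" "T ` S \<subseteq> S"
    and C: "compact C" "T ` S \<subseteq> C"
  obtains u where "u \<in> S" "T u = u"
proof -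
  have CS: "compact (C \<inter> S)" using C S by (simp add: compact_Int_closed)
  have "\<exists>u\<in>S. norm (T u - u) < inverse (real (Suc m))" for m
  proof -
    have "T ` S \<subseteq> C \<inter> S" "0 < inverse (real (Suc m))" using C T by auto
    from schauder_approx[OF S(1,3) T(1) this(1) CS _ this(2)] show ?thesis by blast
  qed
  then obtain u where u: "\<And>m. u m \<in> S" "\<And>m. norm (T (u m) - u m) < inverse (real (Suc m))"
    by metis
  have TC: "T (u m) \<in> C \<inter> S" for m using u T C by auto
  obtain l r where l: "l \<in> C \<inter> S" "strict_mono (r :: nat \<Rightarrow> nat)" "((\<lambda>m. T (u m)) \<circ> r) \<longlonglongrightarrow> l"
    using CS TC unfolding compact_def by meson
  have "(\<lambda>m. T (u m) - u m) \<longlonglongrightarrow> 0"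
    by (rule Lim_null_comparison[OF _ LIMSEQ_inverse_real_of_nat]) (use u(2) less_imp_le in \<open>auto intro!: always_eventually\<close>)
  from LIMSEQ_subseq_LIMSEQ[OF this l(2)] l(3)
  have "(\<lambda>m. T (u (r m)) - (T (u (r m)) - u (r m))) \<longlonglongrightarrow> l - 0"
    by (intro tendsto_diff) (simp_all add: o_def)
  then have ul: "(\<lambda>m. u (r m)) \<longlonglongrightarrow> l" by simp
  have "(\<lambda>m. T (u (r m))) \<longlonglongrightarrow> T l"
    using continuous_on_tendsto_compose[OF T(1) ul] l u by auto
  with l(3) have "T l = l" using LIMSEQ_unique by (auto simp: o_def)
  with l show ?thesis using that by auto
qed

section \<open>Compact integral operators\<close>

text \<open>Each term of a sequence in the closure is replaced by a point of \<open>S\<close> at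
  distance below \<open>1 / (n + 1)\<close>, so convergent subsequences need only be found for
  sequences in \<open>S\<close>.\<close>

lemma compact_closure_sequentiallyI:
  fixes S :: "'a::metric_space set"
  assumes "\<And>\<sigma>::nat \<Rightarrow> 'a. range \<sigma> \<subseteq> S \<Longrightarrow> \<exists>l r. strict_mono r \<and> (\<sigma> \<circ> r) \<longlonglongrightarrow> l"
  shows "compact (closure S)"
  unfolding compact_def
proof (intro allI impI)
  fix f :: "nat \<Rightarrow> 'a" assume f: "\<forall>n. f n \<in> closure S"
  have "\<exists>s\<in>S. dist s (f n) < inverse (real (Suc n))" for n
    using f closure_approachable[of "f n" S] by (metis inverse_positive_iff_positive of_nat_0_less_iff zero_less_Suc)
  then obtain s where s: "\<And>n. s n \<in> S" "\<And>n. dist (s n) (f n) < inverse (real (Suc n))"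
    by metis
  obtain l r where lr: "strict_mono r" "(s \<circ> r) \<longlonglongrightarrow> l"
    using assms[of s] s(1) by auto
  have "(\<lambda>n. dist (s n) (f n)) \<longlonglongrightarrow> 0"
    by (rule tendsto_sandwich[OF _ _ tendsto_const LIMSEQ_inverse_real_of_nat])
       (use s(2) less_imp_le in \<open>auto intro!: always_eventually\<close>)
  then have "(\<lambda>n. dist (s (r n)) (f (r n))) \<longlonglongrightarrow> 0"
    using LIMSEQ_subseq_LIMSEQ[OF _ lr(1)] by (force simp: o_def)
  from tendsto_add[OF this tendsto_dist_iff[THEN iffD1, OF lr(2)]]
  have lim: "(\<lambda>n. dist (s (r n)) (f (r n)) + dist (s (r n)) l) \<longlonglongrightarrow> 0" by (simp add: o_def)
  have "(\<lambda>n. dist (f (r n)) l) \<longlonglongrightarrow> 0"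
  proof (rule Lim_null_comparison[OF _ lim], rule always_eventually, rule allI)
    show "norm (dist (f (r n)) l) \<le> dist (s (r n)) (f (r n)) + dist (s (r n)) l" for n
      using dist_triangle3[of "f (r n)" l "s (r n)"] by simp
  qed
  then have fl: "(f \<circ> r) \<longlonglongrightarrow> l"
    by (subst tendsto_dist_iff) (simp only: o_def)
  have "l \<in> closure S"
    by (rule Lim_in_closed_set[OF closed_closure _ _ fl]) (use f in auto)
  with lr(1) fl show "\<exists>l\<in>closure S. \<exists>r. strict_mono r \<and> (f \<circ> r) \<longlonglongrightarrow> l" by blast
qed

section \<open>Kernels dominated by translates of an integrable function\<close>

lemma lborel_distr_minus: "distr lborel borel (\<lambda>y. x - y) = (lborel :: 'a::euclidean_space measure)"
  by (subst (2) lborel_affine[of "-1" x]) (simp_all add: density_1)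

lemma integrable_lborel_reflect:
  fixes f :: "'a::euclidean_space \<Rightarrow> real"
  assumes "integrable lborel f"
  shows "integrable lborel (\<lambda>y. f (x - y))"
  using assms integrable_distr[of "\<lambda>y. x - y" lborel borel f] by (simp add: lborel_distr_minus)

lemma integral_lborel_reflect:
  fixes f :: "'a::euclidean_space \<Rightarrow> real"
  assumes "f \<in> borel_measurable borel"
  shows "(\<integral>y. f (x - y) \<partial>lborel) = (\<integral>y. f y \<partial>lborel)"
  using integral_distr[of "\<lambda>y. x - y" lborel borel f] assms by (simp add: lborel_distr_minus)

text \<open>The majorant depends on \<open>x - y\<close> alone, so its tails have the same integral
  for every \<open>x\<close>. Continuity in \<open>x\<close> is asked only for almost every
  \<open>y\<close>, which admits a singularity on the diagonal. The finite measure of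
  \<open>B\<close> gives the truncated kernels a common integrable bound.\<close>

locale dominated_kernel =
  fixes S B :: "'a::euclidean_space set" and k :: "'a \<Rightarrow> 'a \<Rightarrow> real" and \<kappa> :: "'a \<Rightarrow> real"
  assumes \<kappa>_integrable: "integrable lborel \<kappa>"
    and k_measurable: "x \<in> S \<Longrightarrow> k x \<in> borel_measurable borel"
    and k_nonneg: "x \<in> S \<Longrightarrow> 0 \<le> k x y"
    and k_le: "x \<in> S \<Longrightarrow> k x y \<le> \<kappa> (x - y)"
    and k_support: "x \<in> S \<Longrightarrow> y \<notin> B \<Longrightarrow> k x y = 0"
    and B: "B \<in> sets borel" "emeasure lborel B < \<infinity>"
    and k_cont: "x \<in> S \<Longrightarrow> AE y in lborel. continuous (at x within S) (\<lambda>x. k x y)"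
begin

lemma k_integrable: "x \<in> S \<Longrightarrow> integrable lborel (k x)"
  by (rule Bochner_Integration.integrable_bound[OF integrable_lborel_reflect[OF \<kappa>_integrable, of x]])
     (use k_measurable k_nonneg[of x] k_le[of x] in \<open>auto intro!: AE_I2 order_trans[OF _ abs_ge_self]\<close>)

lemma integral_k_le: "x \<in> S \<Longrightarrow> (\<integral>y. k x y \<partial>lborel) \<le> (\<integral>y. \<kappa> y \<partial>lborel)"
  using integral_mono[OF k_integrable[of x] integrable_lborel_reflect[OF \<kappa>_integrable, of x]] k_le[of x]
  by (simp add: integral_lborel_reflect borel_measurable_integrable[OF \<kappa>_integrable, simplified])

text \<open>The bound \<open>\<kappa> (x' - y)\<close> moves with \<open>x'\<close>, so dominated
  convergence does not apply directly to the kernel. It does apply to the truncations, along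
  sequences.\<close>

lemma L1_continuous:
  assumes x: "x \<in> S"
  shows "((\<lambda>x'. \<integral>y. \<bar>k x y - k x' y\<bar> \<partial>lborel) \<longlongrightarrow> 0) (at x within S)"
  unfolding tendsto_at_iff_sequentially
proof (intro allI impI)
  fix X :: "nat \<Rightarrow> 'a" assume X': "\<forall>i. X i \<in> S - {x}" and Xx: "X \<longlonglongrightarrow> x"
  from X' have XS: "X i \<in> S" for i by blast
  have [measurable]: "B \<in> sets borel" "\<kappa> \<in> borel_measurable borel"
     "k x \<in> borel_measurable borel" "k (X i) \<in> borel_measurable borel" for i
    using B k_measurable x XS borel_measurable_integrable[OF \<kappa>_integrable] by auto
  define \<eta> where "\<eta> m = (\<integral>z. max 0 (\<kappa> z - real m) \<partial>lborel)" for m :: nat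
  have \<kappa>m: "integrable lborel (\<lambda>z. max 0 (\<kappa> z - real m))" for m
    by (rule Bochner_Integration.integrable_bound[OF \<kappa>_integrable]) auto
  have \<eta>0: "\<eta> \<longlonglongrightarrow> 0"
  proof -
    have "(\<lambda>m. \<integral>z. max 0 (\<kappa> z - real m) \<partial>lborel) \<longlonglongrightarrow> (\<integral>z. 0 \<partial>(lborel :: 'a measure))"
    proof (rule integral_dominated_convergence[where w = "\<lambda>z. \<bar>\<kappa> z\<bar>"])
      have "eventually (\<lambda>m. max 0 (\<kappa> z - real m) = 0) sequentially" for z
      proof -
        obtain m where "\<kappa> z \<le> real m" using real_arch_simple by blast
        then show ?thesis by (intro eventually_sequentiallyI[of m]) auto
      qed
      then show "AE z in lborel. (\<lambda>m. max 0 (\<kappa> z - real m)) \<longlonglongrightarrow> 0"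
        by (intro AE_I2 tendsto_eventually) auto
      show "AE z in lborel. norm (max 0 (\<kappa> z - real m)) \<le> \<bar>\<kappa> z\<bar>" for m by auto
    qed (use \<kappa>_integrable in auto)
    then show ?thesis by (simp add: \<eta>_def [abs_def])
  qed
  \<comment> \<open>Split \<open>k = min m k + (k - m)\<^sup>+\<close>: the first part is bounded, and the second has an integral that is
    small uniformly in the pole, by translation invariance.\<close>
  have trunc: "integrable lborel (\<lambda>y. min (real m) (k z y))"
    "integrable lborel (\<lambda>y. max 0 (k z y - real m))"
    "(\<integral>y. max 0 (k z y - real m) \<partial>lborel) \<le> \<eta> m" if z: "z \<in> S" for z m
  proof -
    have [measurable]: "k z \<in> borel_measurable borel" using k_measurable z by auto
    show "integrable lborel (\<lambda>y. min (real m) (k z y))"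
      by (rule Bochner_Integration.integrable_bound[OF k_integrable[OF z]]) (use k_nonneg[OF z] in auto)
    show i: "integrable lborel (\<lambda>y. max 0 (k z y - real m))"
      by (rule Bochner_Integration.integrable_bound[OF k_integrable[OF z]]) (use k_nonneg[OF z] in auto)
    have "(\<integral>y. max 0 (k z y - real m) \<partial>lborel) \<le> (\<integral>y. max 0 (\<kappa> (z - y) - real m) \<partial>lborel)"
      using k_le[OF z] by (intro integral_mono i integrable_lborel_reflect[OF \<kappa>m]) (auto simp: max.coboundedI2)
    also have "\<dots> = \<eta> m" unfolding \<eta>_def by (rule integral_lborel_reflect) measurable
    finally show "(\<integral>y. max 0 (k z y - real m) \<partial>lborel) \<le> \<eta> m" .
  qed
  have trunc_lim: "(\<lambda>i. \<integral>y. \<bar>min (real m) (k x y) - min (real m) (k (X i) y)\<bar> \<partial>lborel) \<longlonglongrightarrow> 0" for m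
  proof -
    have "(\<lambda>i. \<integral>y. \<bar>min (real m) (k x y) - min (real m) (k (X i) y)\<bar> \<partial>lborel) \<longlonglongrightarrow>
          (\<integral>y. 0 \<partial>(lborel :: 'a measure))"
    proof (rule integral_dominated_convergence[where w = "\<lambda>y. indicator B y *\<^sub>R real m"])
      show "integrable lborel (\<lambda>y. indicator B y *\<^sub>R real m)"
        using B by (intro integrableI_bounded_set_indicator[where B = "real m"]) auto
      show "AE y in lborel. (\<lambda>i. \<bar>min (real m) (k x y) - min (real m) (k (X i) y)\<bar>) \<longlonglongrightarrow> 0"
        using k_cont[OF x]
      proof eventually_elim
        case (elim y)
        then have "(\<lambda>i. k (X i) y) \<longlonglongrightarrow> k x y"
          using X' Xx unfolding continuous_within tendsto_at_iff_sequentially by (auto simp: o_def)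
        then have "(\<lambda>i. \<bar>min (real m) (k x y) - min (real m) (k (X i) y)\<bar>) \<longlonglongrightarrow>
              \<bar>min (real m) (k x y) - min (real m) (k x y)\<bar>"
          by (intro tendsto_intros)
        then show ?case by simp
      qed
      show "AE y in lborel. norm \<bar>min (real m) (k x y) - min (real m) (k (X i) y)\<bar> \<le> indicator B y *\<^sub>R real m" for i
      proof (rule AE_I2)
        fix y
        show "norm \<bar>min (real m) (k x y) - min (real m) (k (X i) y)\<bar> \<le> indicator B y *\<^sub>R real m"
          using k_nonneg[OF x, of y] k_nonneg[OF XS, of i y] k_support[OF x, of y] k_support[OF XS, of y i]
          by (cases "y \<in> B") auto
      qed
    qed auto
    then show ?thesis by simp
  qed
  have le: "(\<integral>y. \<bar>k x y - k (X i) y\<bar> \<partial>lborel) \<le>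
      (\<integral>y. \<bar>min (real m) (k x y) - min (real m) (k (X i) y)\<bar> \<partial>lborel) + 2 * \<eta> m" for i m
  proof -
    have "(\<integral>y. \<bar>k x y - k (X i) y\<bar> \<partial>lborel) \<le>
       (\<integral>y. \<bar>min (real m) (k x y) - min (real m) (k (X i) y)\<bar> +
             (max 0 (k x y - real m) + max 0 (k (X i) y - real m)) \<partial>lborel)"
      using trunc x XS k_integrable by (intro integral_mono) (auto simp: max_def min_def)
    also have "\<dots> = (\<integral>y. \<bar>min (real m) (k x y) - min (real m) (k (X i) y)\<bar> \<partial>lborel) +
        ((\<integral>y. max 0 (k x y - real m) \<partial>lborel) + (\<integral>y. max 0 (k (X i) y - real m) \<partial>lborel))"
      using trunc x XS by simp
    finally show ?thesis using trunc(3)[OF x, of m] trunc(3)[OF XS, of i m] by simp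
  qed
  have "(\<lambda>i. \<integral>y. \<bar>k x y - k (X i) y\<bar> \<partial>lborel) \<longlonglongrightarrow> 0"
  proof (rule LIMSEQ_I)
    fix e :: real assume e: "0 < e"
    \<comment> \<open>The two tails together cost \<open>2 * \<eta> m\<close>, which is below
      \<open>e / 2\<close>.\<close>
    then obtain m where m: "\<eta> m < e / 4"
      using order_tendstoD(2)[OF \<eta>0, of "e/4"] by (auto simp: eventually_sequentially)
    have "eventually (\<lambda>i. (\<integral>y. \<bar>min (real m) (k x y) - min (real m) (k (X i) y)\<bar> \<partial>lborel) < e/2) sequentially"
      using e by (intro order_tendstoD(2)[OF trunc_lim]) simp
    then obtain i0 where i0: "\<And>i. i \<ge> i0 \<Longrightarrow> (\<integral>y. \<bar>min (real m) (k x y) - min (real m) (k (X i) y)\<bar> \<partial>lborel) < e/2"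
      by (auto simp: eventually_sequentially)
    show "\<exists>no. \<forall>n\<ge>no. norm ((\<integral>y. \<bar>k x y - k (X n) y\<bar> \<partial>lborel) - 0) < e"
    proof (intro exI[of _ i0] allI impI)
      fix n assume "i0 \<le> n"
      then show "norm ((\<integral>y. \<bar>k x y - k (X n) y\<bar> \<partial>lborel) - 0) < e"
        using i0[of n] le[of n m] m by (simp add: integral_nonneg_AE)
    qed
  qed
  then show "((\<lambda>x'. \<integral>y. \<bar>k x y - k x' y\<bar> \<partial>lborel) \<circ> X) \<longlonglongrightarrow> 0" by (simp add: o_def)
qed

lemma kh_integrable:
  assumes x: "x \<in> S"
  shows "integrable lborel (\<lambda>y. k x y * apply_bcontfun h y)"
proof (rule Bochner_Integration.integrable_bound[OF integrable_mult_left[OF k_integrable[OF x], of "norm h"]])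
  have "apply_bcontfun h \<in> borel_measurable borel"
    by (intro borel_measurable_continuous_onI) simp
  then show "(\<lambda>y. k x y * apply_bcontfun h y) \<in> borel_measurable lborel"
    using k_measurable[OF x] by simp
  show "AE y in lborel. norm (k x y * apply_bcontfun h y) \<le> norm (k x y * norm h)"
    using norm_bounded[of h] by (intro AE_I2) (simp add: abs_mult mult_left_mono)
qed

lemma abs_integral_kh_le:
  assumes x: "x \<in> S"
  shows "\<bar>\<integral>y. k x y * apply_bcontfun h y \<partial>lborel\<bar> \<le> (\<integral>y. \<kappa> y \<partial>lborel) * norm h"
proof -
  have "\<bar>\<integral>y. k x y * apply_bcontfun h y \<partial>lborel\<bar> \<le> (\<integral>y. norm (k x y * apply_bcontfun h y) \<partial>lborel)"
    using integral_norm_bound[of lborel "\<lambda>y. k x y * apply_bcontfun h y"] by simp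
  also have "\<dots> \<le> (\<integral>y. k x y * norm h \<partial>lborel)"
  proof (rule integral_mono)
    show "integrable lborel (\<lambda>y. norm (k x y * apply_bcontfun h y))"
      using kh_integrable[OF x] by (rule integrable_norm)
    show "integrable lborel (\<lambda>y. k x y * norm h)"
      using k_integrable[OF x] by simp
  qed (use k_nonneg[OF x] norm_bounded[of h] in \<open>auto simp: abs_mult intro!: mult_left_mono\<close>)
  also have "\<dots> \<le> (\<integral>y. \<kappa> y \<partial>lborel) * norm h"
    using integral_k_le[OF x] by (simp add: mult_right_mono)
  finally show ?thesis .
qed

lemma abs_integral_kh_diff_le:
  assumes x: "x \<in> S" "x' \<in> S"
  shows "\<bar>(\<integral>y. k x y * apply_bcontfun h y \<partial>lborel) - (\<integral>y. k x' y * apply_bcontfun h y \<partial>lborel)\<bar>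
    \<le> (\<integral>y. \<bar>k x y - k x' y\<bar> \<partial>lborel) * norm h"
proof -
  have "(\<integral>y. k x y * apply_bcontfun h y \<partial>lborel) - (\<integral>y. k x' y * apply_bcontfun h y \<partial>lborel)
      = (\<integral>y. (k x y - k x' y) * apply_bcontfun h y \<partial>lborel)"
    using kh_integrable x by (simp add: left_diff_distrib)
  also have "\<bar>\<dots>\<bar> \<le> (\<integral>y. norm ((k x y - k x' y) * apply_bcontfun h y) \<partial>lborel)"
    using integral_norm_bound[of lborel "\<lambda>y. (k x y - k x' y) * apply_bcontfun h y"] by simp
  also have "\<dots> \<le> (\<integral>y. \<bar>k x y - k x' y\<bar> * norm h \<partial>lborel)"
  proof (rule integral_mono)
    show "integrable lborel (\<lambda>y. norm ((k x y - k x' y) * apply_bcontfun h y))"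
      using kh_integrable[OF x(1), of h] kh_integrable[OF x(2), of h] by (intro integrable_norm) (simp add: left_diff_distrib)
    show "integrable lborel (\<lambda>y. \<bar>k x y - k x' y\<bar> * norm h)"
      using k_integrable x by (intro integrable_mult_left integrable_abs Bochner_Integration.integrable_diff)
  qed (use norm_bounded[of h] in \<open>auto simp: abs_mult intro!: mult_left_mono\<close>)
  finally show ?thesis by simp
qed

text \<open>\<open>d\<close> is fixed before \<open>h\<close>, so it serves all densities of norm at
  most \<open>M\<close> at once, as Arzela-Ascoli requires. The denominator
  \<open>\<bar>M\<bar> + 1\<close> in the proof is positive whatever the sign of
  \<open>M\<close>.\<close>

lemma equicontinuous:
  assumes x: "x \<in> S" and e: "0 < e"
  obtains d where "0 < d" "\<And>h x'. \<lbrakk>norm h \<le> M; x' \<in> S; dist x' x < d\<rbrakk> \<Longrightarrow>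
     \<bar>(\<integral>y. k x y * apply_bcontfun h y \<partial>lborel) - (\<integral>y. k x' y * apply_bcontfun h y \<partial>lborel)\<bar> < e"
proof -
  have "0 < e / (\<bar>M\<bar> + 1)" using e by simp
  then obtain d where d: "0 < d" "\<And>x'. \<lbrakk>x' \<in> S; 0 < dist x' x; dist x' x < d\<rbrakk> \<Longrightarrow>
       dist (\<integral>y. \<bar>k x y - k x' y\<bar> \<partial>lborel) 0 < e / (\<bar>M\<bar> + 1)"
    using L1_continuous[OF x] unfolding Lim_within by metis
  show ?thesis
  proof (rule that[OF d(1)])
    fix h :: "'a \<Rightarrow>\<^sub>C real" and x' assume h: "norm h \<le> M" and x': "x' \<in> S" "dist x' x < d"
    let ?I = "\<integral>y. \<bar>k x y - k x' y\<bar> \<partial>lborel"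
    have I: "?I < e / (\<bar>M\<bar> + 1)"
    proof (cases "x' = x")
      case False then show ?thesis using d(2)[of x'] x' by (simp add: dist_real_def)
    qed (use e in simp)
    have "?I * norm h \<le> ?I * (\<bar>M\<bar> + 1)"
      using h by (intro mult_left_mono) (auto intro: integral_nonneg_AE)
    also have "\<dots> < e" using I by (simp add: field_simps)
    finally show "\<bar>(\<integral>y. k x y * apply_bcontfun h y \<partial>lborel) - (\<integral>y. k x' y * apply_bcontfun h y \<partial>lborel)\<bar> < e"
      using abs_integral_kh_diff_le[OF x x'(1), of h] by linarith
  qed
qed

end

section \<open>Order intervals and normalised potentials\<close>

definition order_interval :: "real \<Rightarrow> ('a::metric_space \<Rightarrow>\<^sub>C real) set" where
  "order_interval r = {u. \<forall>x. apply_bcontfun u x \<in> {0..r}}"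

lemma closed_order_interval: "closed (order_interval r :: ('a::metric_space \<Rightarrow>\<^sub>C real) set)"
proof -
  have "(order_interval r :: ('a \<Rightarrow>\<^sub>C real) set) = PiC UNIV (\<lambda>_. {0..r})" by (auto simp: order_interval_def mem_PiC_iff Pi_iff)
  then show ?thesis by (simp add: closed_PiC)
qed

lemma convex_order_interval: "convex (order_interval r)"
proof (rule convexI)
  fix u v :: "'a \<Rightarrow>\<^sub>C real" and s t :: real
  assume uv: "u \<in> order_interval r" "v \<in> order_interval r" and st: "0 \<le> s" "0 \<le> t" "s + t = 1"
  show "s *\<^sub>R u + t *\<^sub>R v \<in> order_interval r"
    using uv st convexD[OF convex_real_interval(5)[of 0 r]] by (auto simp: order_interval_def)
qed

text \<open>Convexity makes the nearest-point projection onto \<open>S\<close> continuous; through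
  it functions on \<open>S\<close> are extended to the whole space without enlarging their
  range.\<close>

locale compact_kernel = dominated_kernel S B k \<kappa>
  for S B :: "'a::euclidean_space set" and k :: "'a \<Rightarrow> 'a \<Rightarrow> real" and \<kappa> :: "'a \<Rightarrow> real" +
  assumes S: "compact S" "convex S" "S \<noteq> {}"
begin

abbreviation "proj \<equiv> closest_point S"

lemma proj_in: "proj x \<in> S"
  using S compact_imp_closed by (intro closest_point_in_set) auto

lemma continuous_on_proj: "continuous_on A proj"
  using S compact_imp_closed by (intro continuous_on_closest_point) auto

definition integral_op :: "('a \<Rightarrow>\<^sub>C real) \<Rightarrow> ('a \<Rightarrow>\<^sub>C real)" where
  "integral_op h = Bcontfun (\<lambda>x. \<integral>y. k (proj x) y * apply_bcontfun h y \<partial>lborel)"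

lemma continuous_on_integral_kh: "continuous_on S (\<lambda>x. \<integral>y. k x y * apply_bcontfun h y \<partial>lborel)"
  unfolding continuous_on_iff
proof (intro ballI allI impI)
  fix x e assume x: "x \<in> S" and e: "0 < (e::real)"
  from equicontinuous[OF x e, of "norm h"] obtain d where
    "0 < d" "\<And>x'. \<lbrakk>x' \<in> S; dist x' x < d\<rbrakk> \<Longrightarrow>
     \<bar>(\<integral>y. k x y * apply_bcontfun h y \<partial>lborel) - (\<integral>y. k x' y * apply_bcontfun h y \<partial>lborel)\<bar> < e"
    by (metis order_refl)
  then show "\<exists>d>0. \<forall>x'\<in>S. dist x' x < d \<longrightarrow>
    dist (\<integral>y. k x' y * apply_bcontfun h y \<partial>lborel) (\<integral>y. k x y * apply_bcontfun h y \<partial>lborel) < e"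
    by (intro exI[of _ d]) (auto simp: dist_real_def abs_minus_commute)
qed

lemma integral_op_apply [simp]:
  "apply_bcontfun (integral_op h) x = (\<integral>y. k (proj x) y * apply_bcontfun h y \<partial>lborel)"
proof -
  have "(\<lambda>x. \<integral>y. k (proj x) y * apply_bcontfun h y \<partial>lborel) \<in> bcontfun"
    using proj_in abs_integral_kh_le[OF proj_in]
    by (intro bcontfun_normI continuous_on_compose2[OF continuous_on_integral_kh continuous_on_proj]) auto
  then show ?thesis by (simp add: integral_op_def Bcontfun_inverse)
qed

lemma bounded_linear_integral_op: "bounded_linear integral_op"
proof (rule bounded_linear_intro)
  show "integral_op (h + h') = integral_op h + integral_op h'" for h h'
    using kh_integrable[OF proj_in] by (intro bcontfun_eqI) (simp add: distrib_left)
  show "integral_op (c *\<^sub>R h) = c *\<^sub>R integral_op h" for c h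
    by (intro bcontfun_eqI) (simp add: mult.left_commute)
  show "norm (integral_op h) \<le> norm h * (\<integral>y. \<kappa> y \<partial>lborel)" for h
    using abs_integral_kh_le[OF proj_in] by (intro norm_bound) (simp add: mult.commute)
qed

lemma integral_op_mono:
  assumes "\<And>y. apply_bcontfun h y \<le> apply_bcontfun h' y"
  shows "apply_bcontfun (integral_op h) x \<le> apply_bcontfun (integral_op h') x"
  using kh_integrable[OF proj_in] k_nonneg[OF proj_in] assms
  by (auto intro!: integral_mono mult_left_mono)

text \<open>Arzela-Ascoli is applied on the compact set \<open>S\<close>. Convergence is then
  uniform on the whole space because every value is taken at a projected point.\<close>

lemma compact_integral_op: "compact (closure (integral_op ` cball 0 M))"
proof (rule compact_closure_sequentiallyI)
  fix \<sigma> :: "nat \<Rightarrow> 'a \<Rightarrow>\<^sub>C real" assume "range \<sigma> \<subseteq> integral_op ` cball 0 M"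
  then have "\<sigma> n \<in> integral_op ` cball 0 M" for n by blast
  then have "\<forall>n. \<exists>h. norm h \<le> M \<and> \<sigma> n = integral_op h" by (fastforce simp: image_iff)
  then obtain h where h: "\<And>n. norm (h n) \<le> M" "\<And>n. \<sigma> n = integral_op (h n)" by metis
  define F where "F n x = (\<integral>y. k x y * apply_bcontfun (h n) y \<partial>lborel)" for n x
  \<comment> \<open>The sign is inherited from the kernel and allows
    \<open>norm (h n) \<le> M\<close> to be multiplied by this integral.\<close>
  have \<kappa>0: "0 \<le> (\<integral>y. \<kappa> y \<partial>lborel)"
  proof -
    obtain x where "x \<in> S" using S by blast
    then have "0 \<le> (\<integral>y. k x y \<partial>lborel)" using k_nonneg by (intro integral_nonneg_AE) auto
    then show ?thesis using integral_k_le[OF \<open>x \<in> S\<close>] by simp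
  qed
  have bnd: "norm (F n x) \<le> (\<integral>y. \<kappa> y \<partial>lborel) * M" if "x \<in> S" for n x
    using order_trans[OF abs_integral_kh_le[OF that, of "h n"] mult_left_mono[OF h(1) \<kappa>0]] by (simp add: F_def)
  have equi: "\<exists>d. 0 < d \<and> (\<forall>n y. y \<in> S \<and> norm (x - y) < d \<longrightarrow> norm (F n x - F n y) < e)"
    if x: "x \<in> S" and e: "0 < e" for x e
  proof -
    from equicontinuous[OF x e, of M] obtain d where
      "0 < d" "\<And>h x'. \<lbrakk>norm h \<le> M; x' \<in> S; dist x' x < d\<rbrakk> \<Longrightarrow>
       \<bar>(\<integral>y. k x y * apply_bcontfun h y \<partial>lborel) - (\<integral>y. k x' y * apply_bcontfun h y \<partial>lborel)\<bar> < e"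
      by blast
    then show ?thesis using h(1) by (intro exI[of _ d]) (auto simp: F_def dist_norm norm_minus_commute)
  qed
  obtain g r where g: "continuous_on S g" and r: "strict_mono (r :: nat \<Rightarrow> nat)"
    and lim: "\<And>e. 0 < e \<Longrightarrow> \<exists>N. \<forall>n x. n \<ge> N \<and> x \<in> S \<longrightarrow> norm (F (r n) x - g x) < e"
    using Arzela_Ascoli[OF S(1) bnd equi] by blast
  obtain b where b: "\<And>x. x \<in> S \<Longrightarrow> norm (g x) \<le> b"
    using compact_imp_bounded[OF compact_continuous_image[OF g S(1)]] by (auto simp: bounded_iff)
  define l where "l = Bcontfun (\<lambda>x. g (proj x))"
  have l: "apply_bcontfun l x = g (proj x)" for x
  proof -
    have "(\<lambda>x. g (proj x)) \<in> bcontfun"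
      using proj_in b by (intro bcontfun_normI continuous_on_compose2[OF g continuous_on_proj]) auto
    then show ?thesis by (simp add: l_def Bcontfun_inverse)
  qed
  have "(\<sigma> \<circ> r) \<longlonglongrightarrow> l"
  proof (rule metric_LIMSEQ_I)
    fix e :: real assume e: "0 < e"
    then obtain N where N: "\<And>n x. \<lbrakk>n \<ge> N; x \<in> S\<rbrakk> \<Longrightarrow> norm (F (r n) x - g x) < e / 2"
      using lim[of "e/2"] by auto
    have "dist ((\<sigma> \<circ> r) n) l \<le> e / 2" if "N \<le> n" for n
      using N[OF that proj_in] by (intro dist_bound) (auto simp: h l F_def dist_norm less_imp_le)
    then show "\<exists>no. \<forall>n\<ge>no. dist ((\<sigma> \<circ> r) n) l < e"
      using e by (intro exI[of _ N] allI impI) (force intro: le_less_trans[of _ "e / 2"])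
  qed
  with r show "\<exists>l r. strict_mono r \<and> (\<sigma> \<circ> r) \<longlonglongrightarrow> l" by blast
qed

text \<open>The lower bound \<open>m\<close> keeps the denominator away from 0, which gives
  continuity, and confines the scalar factors to \<open>{0..r / m}\<close>, so that the image lies
  in the continuous image of a compact product.\<close>

lemma normalized_integral_op:
  fixes N :: "'w::topological_space \<Rightarrow> ('a \<Rightarrow>\<^sub>C real)"
  assumes r: "0 < r" and N: "continuous_on Q N"
    and M: "\<And>w. w \<in> Q \<Longrightarrow> norm (N w) \<le> M"
    and nonneg: "\<And>w y. w \<in> Q \<Longrightarrow> 0 \<le> apply_bcontfun (N w) y"
    and m: "0 < m" "\<And>w. w \<in> Q \<Longrightarrow> m \<le> norm (integral_op (N w))"
  defines "T \<equiv> \<lambda>w. (r / norm (integral_op (N w))) *\<^sub>R integral_op (N w)"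
  shows "continuous_on Q T" and "T ` Q \<subseteq> order_interval r"
    and "\<exists>C. compact C \<and> T ` Q \<subseteq> C"
proof -
  show "continuous_on Q T"
    unfolding T_def
    by (intro continuous_intros bounded_linear.continuous_on[OF bounded_linear_integral_op] N) (use m in force)
  show "T ` Q \<subseteq> order_interval r"
  proof (rule image_subsetI)
    fix w assume w: "w \<in> Q"
    let ?A = "integral_op (N w)"
    have p: "0 < norm ?A" using m w by force
    have "0 \<le> apply_bcontfun ?A x \<and> apply_bcontfun ?A x \<le> norm ?A" for x
      using integral_op_mono[of 0 "N w" x] nonneg[OF w] norm_bounded[of ?A x] by simp
    then have "apply_bcontfun (T w) x \<in> {0..r}" for x
      using p r by (simp add: T_def mult_imp_div_pos_le mult_left_mono del: integral_op_apply)
    then show "T w \<in> order_interval r" by (simp add: order_interval_def)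
  qed
  let ?K = "closure (integral_op ` cball 0 M)"
  have "compact ((\<lambda>(t, z). t *\<^sub>R z) ` ({0..r / m} \<times> ?K))"
    unfolding case_prod_unfold
    by (intro compact_continuous_image compact_Times compact_Icc compact_integral_op continuous_intros)
  moreover have "T ` Q \<subseteq> (\<lambda>(t, z). t *\<^sub>R z) ` ({0..r / m} \<times> ?K)"
  proof (rule image_subsetI)
    fix w assume w: "w \<in> Q"
    have "integral_op (N w) \<in> ?K" using M[OF w] by (intro subsetD[OF closure_subset] imageI) simp
    moreover have "r / norm (integral_op (N w)) \<in> {0..r / m}"
      using m(1) m(2)[OF w] r less_le_trans[OF m(1) m(2)[OF w]]
      by (simp add: divide_left_mono mult_pos_pos)
    ultimately show "T w \<in> (\<lambda>(t, z). t *\<^sub>R z) ` ({0..r / m} \<times> ?K)"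
      unfolding T_def by (intro image_eqI[where x = "(r / norm (integral_op (N w)), integral_op (N w))"]) auto
  qed
  ultimately show "\<exists>C. compact C \<and> T ` Q \<subseteq> C" by blast
qed

text \<open>The Nemytskii operator of \<open>f\<close>, taken at projected points because
  \<open>f\<close> is controlled over \<open>S\<close> only.\<close>

definition superposition :: "('a \<Rightarrow> real \<Rightarrow> real \<Rightarrow> real) \<Rightarrow> ('a \<Rightarrow>\<^sub>C real) \<times> ('a \<Rightarrow>\<^sub>C real) \<Rightarrow> ('a \<Rightarrow>\<^sub>C real)" where
  "superposition f w = Bcontfun (\<lambda>y. f (proj y) (apply_bcontfun (fst w) (proj y)) (apply_bcontfun (snd w) (proj y)))"

context
  fixes f :: "'a \<Rightarrow> real \<Rightarrow> real \<Rightarrow> real" and r1 r2 :: real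
  assumes f: "continuous_on (S \<times> {0..r1} \<times> {0..r2}) (\<lambda>(x, u, v). f x u v)"
begin

lemma superposition_bound:
  obtains M where "\<And>x u v. \<lbrakk>x \<in> S; u \<in> {0..r1}; v \<in> {0..r2}\<rbrakk> \<Longrightarrow> \<bar>f x u v\<bar> \<le> M"
proof -
  have "compact ((\<lambda>(x, u, v). f x u v) ` (S \<times> {0..r1} \<times> {0..r2}))"
    by (intro compact_continuous_image f compact_Times S compact_Icc)
  from compact_imp_bounded[OF this]
  obtain M where M: "\<forall>z\<in>(\<lambda>(x, u, v). f x u v) ` (S \<times> {0..r1} \<times> {0..r2}). norm z \<le> M"
    unfolding bounded_iff by blast
  show ?thesis
  proof (rule that[of M])
    fix x u v assume "x \<in> S" "u \<in> {0..r1}" "v \<in> {0..r2}"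
    then have "(x, u, v) \<in> S \<times> {0..r1} \<times> {0..r2}" by blast
    from bspec[OF M imageI[OF this]] show "\<bar>f x u v\<bar> \<le> M" by simp
  qed
qed

lemma superposition_apply:
  assumes w: "w \<in> order_interval r1 \<times> order_interval r2"
  shows "apply_bcontfun (superposition f w) y =
    f (proj y) (apply_bcontfun (fst w) (proj y)) (apply_bcontfun (snd w) (proj y))"
proof -
  have r: "apply_bcontfun (fst w) x \<in> {0..r1}" "apply_bcontfun (snd w) x \<in> {0..r2}" for x
    using w by (auto simp: order_interval_def)
  obtain M where M: "\<And>x u v. \<lbrakk>x \<in> S; u \<in> {0..r1}; v \<in> {0..r2}\<rbrakk> \<Longrightarrow> \<bar>f x u v\<bar> \<le> M"
    using superposition_bound by blast
  let ?g = "\<lambda>y. (proj y, apply_bcontfun (fst w) (proj y), apply_bcontfun (snd w) (proj y))"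
  have "continuous_on UNIV ?g"
    by (intro continuous_on_Pair continuous_on_proj continuous_on_compose2[OF _ continuous_on_proj]
        continuous_on_apply_bcontfun) auto
  then have "continuous_on UNIV (\<lambda>y. (\<lambda>(x, u, v). f x u v) (?g y))"
    by (rule continuous_on_compose2[OF f]) (use r proj_in in auto)
  then have "(\<lambda>y. f (proj y) (apply_bcontfun (fst w) (proj y)) (apply_bcontfun (snd w) (proj y))) \<in> bcontfun"
    using M r proj_in by (intro bcontfun_normI[where b = M]) auto
  then show ?thesis by (simp add: superposition_def Bcontfun_inverse)
qed

text \<open>Uniform continuity of \<open>f\<close> on the compact box turns sup-norm closeness of
  the arguments into closeness uniform in \<open>y\<close>, since evaluation at a point does not
  increase distances.\<close>

lemma continuous_on_superposition:
  "continuous_on (order_interval r1 \<times> order_interval r2) (superposition f)"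
  unfolding continuous_on_iff
proof (intro ballI allI impI)
  let ?Q = "order_interval r1 \<times> order_interval r2 :: (('a \<Rightarrow>\<^sub>C real) \<times> ('a \<Rightarrow>\<^sub>C real)) set"
  fix w e assume w: "w \<in> ?Q" and e: "0 < (e::real)"
  have "uniformly_continuous_on (S \<times> {0..r1} \<times> {0..r2}) (\<lambda>(x, u, v). f x u v)"
    by (intro compact_uniformly_continuous f compact_Times S compact_Icc)
  then obtain d where d: "0 < d" and
    fd: "\<And>p q. \<lbrakk>p \<in> S \<times> {0..r1} \<times> {0..r2}; q \<in> S \<times> {0..r1} \<times> {0..r2}; dist q p < d\<rbrakk> \<Longrightarrow>
      dist ((\<lambda>(x, u, v). f x u v) q) ((\<lambda>(x, u, v). f x u v) p) < e / 2"
    using e unfolding uniformly_continuous_on_def by (meson half_gt_zero)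
  show "\<exists>d>0. \<forall>w'\<in>?Q. dist w' w < d \<longrightarrow> dist (superposition f w') (superposition f w) < e"
  proof (intro exI[of _ d] conjI ballI impI d)
    fix w' assume w': "w' \<in> ?Q" and dist: "dist w' w < d"
    have "dist (superposition f w') (superposition f w) \<le> e / 2"
    proof (rule dist_bound)
      fix y
      let ?g = "\<lambda>w. (proj y, apply_bcontfun (fst w) (proj y), apply_bcontfun (snd w) (proj y))"
      have "dist (?g w') (?g w) \<le> dist w' w"
        unfolding dist_prod_def by (simp add: dist_bounded power_mono add_mono real_sqrt_le_mono)
      then have "dist (?g w') (?g w) < d" using dist by simp
      moreover have "?g w \<in> S \<times> {0..r1} \<times> {0..r2}" "?g w' \<in> S \<times> {0..r1} \<times> {0..r2}"
        using w w' proj_in by (auto simp: order_interval_def)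
      ultimately show "dist (apply_bcontfun (superposition f w') y) (apply_bcontfun (superposition f w) y) \<le> e / 2"
        using fd[of "?g w" "?g w'"] w w' by (simp add: superposition_apply)
    qed
    then show "dist (superposition f w') (superposition f w) < e" using e by simp
  qed
qed

end

text \<open>The potential of \<open>f_low\<close> at the single point \<open>a\<close> supplies the
  lower bound for the norms: the integral operator is monotone, and a value never exceeds the norm.
  The same holds for \<open>g_low\<close> at \<open>b\<close>. The assumptions
  \<open>f_low_proj\<close> and \<open>g_low_proj\<close> carry the pointwise comparison from
  \<open>S\<close> to the whole space.\<close>

theorem normalized_eigenpair:
  fixes f g :: "'a \<Rightarrow> real \<Rightarrow> real \<Rightarrow> real"
  assumes r: "0 < r1" "0 < r2"
    and f: "continuous_on (S \<times> {0..r1} \<times> {0..r2}) (\<lambda>(x, u, v). f x u v)"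
    and g: "continuous_on (S \<times> {0..r1} \<times> {0..r2}) (\<lambda>(x, u, v). g x u v)"
    and f_low: "\<And>x u v. \<lbrakk>x \<in> S; u \<in> {0..r1}; v \<in> {0..r2}\<rbrakk> \<Longrightarrow> apply_bcontfun f_low x \<le> f x u v"
    and g_low: "\<And>x u v. \<lbrakk>x \<in> S; u \<in> {0..r1}; v \<in> {0..r2}\<rbrakk> \<Longrightarrow> apply_bcontfun g_low x \<le> g x u v"
    and f_nonneg: "\<And>x u v. \<lbrakk>x \<in> S; u \<in> {0..r1}; v \<in> {0..r2}\<rbrakk> \<Longrightarrow> 0 \<le> f x u v"
    and g_nonneg: "\<And>x u v. \<lbrakk>x \<in> S; u \<in> {0..r1}; v \<in> {0..r2}\<rbrakk> \<Longrightarrow> 0 \<le> g x u v"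
    and f_low_proj: "\<And>y. apply_bcontfun f_low (proj y) = apply_bcontfun f_low y"
    and g_low_proj: "\<And>y. apply_bcontfun g_low (proj y) = apply_bcontfun g_low y"
    and pos: "0 < apply_bcontfun (integral_op f_low) a" "0 < apply_bcontfun (integral_op g_low) b"
  obtains u v lam1 lam2 where "u \<in> order_interval r1" "v \<in> order_interval r2" "norm u = r1" "norm v = r2"
    "0 < lam1" "0 < lam2" "u = lam1 *\<^sub>R integral_op (superposition f (u, v))"
    "v = lam2 *\<^sub>R integral_op (superposition g (u, v))"
proof -
  let ?Q = "order_interval r1 \<times> order_interval r2 :: (('a \<Rightarrow>\<^sub>C real) \<times> ('a \<Rightarrow>\<^sub>C real)) set"
  have comp: "0 \<le> apply_bcontfun (superposition h w) y"
    "apply_bcontfun (integral_op h_low) c \<le> norm (integral_op (superposition h w))"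
    if h: "continuous_on (S \<times> {0..r1} \<times> {0..r2}) (\<lambda>(x, u, v). h x u v)"
      and low: "\<And>x u v. \<lbrakk>x \<in> S; u \<in> {0..r1}; v \<in> {0..r2}\<rbrakk> \<Longrightarrow> apply_bcontfun h_low x \<le> h x u v"
      and h0: "\<And>x u v. \<lbrakk>x \<in> S; u \<in> {0..r1}; v \<in> {0..r2}\<rbrakk> \<Longrightarrow> 0 \<le> h x u v"
      and hp: "\<And>y. apply_bcontfun h_low (proj y) = apply_bcontfun h_low y"
      and w: "w \<in> ?Q" for h h_low c w y
  proof -
    have rng: "apply_bcontfun (fst w) x \<in> {0..r1}" "apply_bcontfun (snd w) x \<in> {0..r2}" for x
      using w by (auto simp: order_interval_def)
    show "0 \<le> apply_bcontfun (superposition h w) y"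
      unfolding superposition_apply[OF h w] by (intro h0 proj_in rng)
    have "apply_bcontfun h_low y \<le> apply_bcontfun (superposition h w) y" for y
      unfolding superposition_apply[OF h w] hp[of y, symmetric] by (intro low proj_in rng)
    then have "apply_bcontfun (integral_op h_low) c \<le> apply_bcontfun (integral_op (superposition h w)) c"
      by (rule integral_op_mono)
    also have "\<dots> \<le> norm (integral_op (superposition h w))"
      using norm_bounded[of "integral_op (superposition h w)" c] by (simp del: integral_op_apply)
    finally show "apply_bcontfun (integral_op h_low) c \<le> norm (integral_op (superposition h w))" .
  qed
  have bound: "\<exists>M. \<forall>w\<in>?Q. norm (superposition h w) \<le> M"
    if h: "continuous_on (S \<times> {0..r1} \<times> {0..r2}) (\<lambda>(x, u, v). h x u v)" for h
  proof -
    obtain M where M: "\<And>x u v. \<lbrakk>x \<in> S; u \<in> {0..r1}; v \<in> {0..r2}\<rbrakk> \<Longrightarrow> \<bar>h x u v\<bar> \<le> M"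
      using superposition_bound[OF h] by blast
    have "norm (superposition h w) \<le> M" if w: "w \<in> ?Q" for w
    proof (rule norm_bound)
      have "apply_bcontfun (fst w) x \<in> {0..r1}" "apply_bcontfun (snd w) x \<in> {0..r2}" for x
        using w by (auto simp: order_interval_def)
      then show "norm (apply_bcontfun (superposition h w) y) \<le> M" for y
        unfolding superposition_apply[OF h w] real_norm_def by (intro M proj_in)
    qed
    then show ?thesis by blast
  qed
  obtain Mf Mg where Mf: "\<And>w. w \<in> ?Q \<Longrightarrow> norm (superposition f w) \<le> Mf"
    and Mg: "\<And>w. w \<in> ?Q \<Longrightarrow> norm (superposition g w) \<le> Mg"
    using bound[OF f] bound[OF g] by blast
  let ?A = "\<lambda>w. integral_op (superposition f w)" and ?B = "\<lambda>w. integral_op (superposition g w)"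
  have compf: "0 \<le> apply_bcontfun (superposition f w) y" "apply_bcontfun (integral_op f_low) a \<le> norm (?A w)"
    if "w \<in> ?Q" for w y
    by (rule comp[of f f_low], rule f, erule (2) f_low, erule (2) f_nonneg, rule f_low_proj, rule that)+
  have compg: "0 \<le> apply_bcontfun (superposition g w) y" "apply_bcontfun (integral_op g_low) b \<le> norm (?B w)"
    if "w \<in> ?Q" for w y
    by (rule comp[of g g_low], rule g, erule (2) g_low, erule (2) g_nonneg, rule g_low_proj, rule that)+
  have A: "continuous_on ?Q (\<lambda>w. (r1 / norm (?A w)) *\<^sub>R ?A w)"
    "(\<lambda>w. (r1 / norm (?A w)) *\<^sub>R ?A w) ` ?Q \<subseteq> order_interval r1"
    "\<exists>C. compact C \<and> (\<lambda>w. (r1 / norm (?A w)) *\<^sub>R ?A w) ` ?Q \<subseteq> C"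
    by (rule normalized_integral_op[OF r(1) continuous_on_superposition[OF f] Mf compf(1) pos(1) compf(2)]; assumption)+
  have B: "continuous_on ?Q (\<lambda>w. (r2 / norm (?B w)) *\<^sub>R ?B w)"
    "(\<lambda>w. (r2 / norm (?B w)) *\<^sub>R ?B w) ` ?Q \<subseteq> order_interval r2"
    "\<exists>C. compact C \<and> (\<lambda>w. (r2 / norm (?B w)) *\<^sub>R ?B w) ` ?Q \<subseteq> C"
    by (rule normalized_integral_op[OF r(2) continuous_on_superposition[OF g] Mg compg(1) pos(2) compg(2)]; assumption)+
  define T where "T w = ((r1 / norm (?A w)) *\<^sub>R ?A w, (r2 / norm (?B w)) *\<^sub>R ?B w)" for w
  obtain CA CB where C: "compact CA" "compact CB"
    "\<And>w. w \<in> ?Q \<Longrightarrow> (r1 / norm (?A w)) *\<^sub>R ?A w \<in> CA" "\<And>w. w \<in> ?Q \<Longrightarrow> (r2 / norm (?B w)) *\<^sub>R ?B w \<in> CB"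
    using A(3) B(3) unfolding image_subset_iff by blast
  have "0 \<in> order_interval r1" "0 \<in> order_interval r2" using r by (auto simp: order_interval_def)
  then have ne: "?Q \<noteq> {}" by blast
  obtain w where w: "w \<in> ?Q" "T w = w"
  proof (rule schauder[of ?Q T "CA \<times> CB"])
    show "convex ?Q" by (intro convex_Times convex_order_interval)
    show "closed ?Q" by (intro closed_Times closed_order_interval)
    show "continuous_on ?Q T" unfolding T_def [abs_def] by (intro continuous_on_Pair A(1) B(1))
    show "T ` ?Q \<subseteq> ?Q" using A(2) B(2) by (fastforce simp: T_def image_subset_iff)
    show "compact (CA \<times> CB)" using C by (intro compact_Times)
    show "T ` ?Q \<subseteq> CA \<times> CB" using C(3,4) by (fastforce simp: T_def image_subset_iff)
  qed (use ne in auto)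
  have p: "0 < norm (?A w)" "0 < norm (?B w)"
    using compf(2)[OF w(1)] compg(2)[OF w(1)] pos by linarith+
  have u: "fst w = (r1 / norm (?A w)) *\<^sub>R ?A w" and v: "snd w = (r2 / norm (?B w)) *\<^sub>R ?B w"
    using arg_cong[OF w(2), of fst] arg_cong[OF w(2), of snd] by (simp_all add: T_def)
  show ?thesis
  proof (rule that[of "fst w" "snd w" "r1 / norm (?A w)" "r2 / norm (?B w)"])
    show "norm (fst w) = r1" "norm (snd w) = r2"
      using arg_cong[OF u, of norm] arg_cong[OF v, of norm] p r by simp_all
  qed (use w(1) u v p r in auto)
qed

end

section \<open>The Green's function of the unit ball\<close>

lemma second_derivative_nonpos_at_max:
  fixes g g' :: "real \<Rightarrow> real"
  assumes d: "0 < d"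
    and g: "\<And>t. \<bar>t\<bar> < d \<Longrightarrow> (g has_real_derivative g' t) (at t)"
    and g': "(g' has_real_derivative L) (at 0)"
    and max: "\<And>t. \<bar>t\<bar> < d \<Longrightarrow> g t \<le> g 0"
  shows "L \<le> 0"
proof (rule ccontr)
  assume "\<not> L \<le> 0"
  then have L: "0 < L" by simp
  \<comment> \<open>If \<open>L\<close> is positive, \<open>g'\<close> leaves its zero at 0 upwards,
    and \<open>g\<close> would increase to the right of its maximum.\<close>
  have g'0: "g' 0 = 0"
    using DERIV_local_max[OF g[of 0] d] d max by simp
  obtain d' where d': "0 < d'" "\<And>h. \<lbrakk>0 < h; h < d'\<rbrakk> \<Longrightarrow> g' 0 < g' h"
    using DERIV_pos_inc_right[OF g' L] by auto
  define h where "h = min d d' / 2"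
  have h: "0 < h" "h < d" "h < d'" using d d' by (auto simp: h_def)
  have "g 0 < g h"
  proof (rule DERIV_pos_imp_increasing_open[OF h(1)])
    show "\<exists>y. (g has_real_derivative y) (at x) \<and> 0 < y" if "0 < x" "x < h" for x
      using g[of x] d'(2)[of x] that h g'0 by auto
    show "continuous_on {0..h} g"
      by (rule DERIV_continuous_on[OF has_field_derivative_at_within[OF g]]) (use h in auto)
  qed
  moreover have "g h \<le> g 0" by (rule max) (use h in linarith)
  ultimately show False by linarith
qed

lemma differentiable_imp_line_derivative:
  fixes u :: "'a::euclidean_space \<Rightarrow> real"
  assumes "u differentiable (at (z + t *\<^sub>R b))"
  shows "((\<lambda>t. u (z + t *\<^sub>R b)) has_real_derivative partial_deriv b u (z + t *\<^sub>R b)) (at t)"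
proof -
  let ?D = "frechet_derivative u (at (z + t *\<^sub>R b))"
  have 1: "((\<lambda>t. z + t *\<^sub>R b) has_derivative (\<lambda>h. h *\<^sub>R b)) (at t)"
    by (auto intro!: derivative_eq_intros)
  have 2: "(u has_derivative ?D) (at (z + t *\<^sub>R b))"
    using assms frechet_derivative_works by blast
  have "((\<lambda>t. u (z + t *\<^sub>R b)) has_derivative (\<lambda>h. ?D (h *\<^sub>R b))) (at t)"
    using has_derivative_compose[OF 1 2] .
  moreover have "?D (h *\<^sub>R b) = partial_deriv b u (z + t *\<^sub>R b) * h" for h
    using linear_cmul[OF linear_frechet_derivative[OF assms]] by (simp add: partial_deriv_def)
  ultimately show ?thesis by (simp add: has_field_derivative_def)
qed

text \<open>Applied in both directions, this shows that correctors with the same boundary values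
  coincide, so the Green's function can be computed from any explicit corrector.\<close>

lemma harmonic_on_le:
  fixes \<phi> \<psi> :: "'a::euclidean_space \<Rightarrow> real"
  assumes \<Omega>: "open \<Omega>" "bounded \<Omega>"
    and \<phi>: "continuous_on (closure \<Omega>) \<phi>" "harmonic_on \<Omega> \<phi>"
    and \<psi>: "continuous_on (closure \<Omega>) \<psi>" "harmonic_on \<Omega> \<psi>"
    and le: "\<And>x. x \<in> frontier \<Omega> \<Longrightarrow> \<phi> x \<le> \<psi> x"
    and x: "x \<in> closure \<Omega>"
  shows "\<phi> x \<le> \<psi> x"
proof (rule ccontr)
  assume "\<not> \<phi> x \<le> \<psi> x"
  define w where "w x = \<phi> x - \<psi> x" for x
  have wx: "0 < w x" using \<open>\<not> \<phi> x \<le> \<psi> x\<close> by (simp add: w_def)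
  have cpt: "compact (closure \<Omega>)" using \<Omega> by simp
  obtain R where R: "\<And>y. y \<in> closure \<Omega> \<Longrightarrow> y \<bullet> y \<le> R" "0 < R"
  proof -
    obtain R where "\<And>y. y \<in> closure \<Omega> \<Longrightarrow> norm y \<le> R" "0 < R"
      using compact_imp_bounded[OF cpt] unfolding bounded_pos by auto
    then show thesis using that[of "R\<^sup>2"] by (auto simp: power_mono simp flip: power2_norm_eq_inner)
  qed
  \<comment> \<open>\<open>\<epsilon> * R\<close> is half of \<open>w x\<close>, so the quadratic
    term cannot lift the values on the frontier up to \<open>v x\<close>.\<close>
  define \<epsilon> where "\<epsilon> = w x / (2 * R)"
  have \<epsilon>: "0 < \<epsilon>" using wx R by (simp add: \<epsilon>_def)
  \<comment> \<open>the quadratic term makes the Laplacian strictly positive, which excludes an interior maximum\<close>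
  define v where "v y = w y + \<epsilon> * (y \<bullet> y)" for y
  have "continuous_on (closure \<Omega>) v"
    unfolding v_def w_def by (intro continuous_intros \<phi> \<psi>)
  from continuous_attains_sup[OF cpt _ this]
  obtain z where z: "z \<in> closure \<Omega>" "\<And>y. y \<in> closure \<Omega> \<Longrightarrow> v y \<le> v z"
    using x by (metis empty_iff)
  have "z \<notin> frontier \<Omega>"
  proof
    assume "z \<in> frontier \<Omega>"
    then have "w z \<le> 0" using le[of z] by (simp add: w_def)
    moreover have "\<epsilon> * (z \<bullet> z) \<le> \<epsilon> * R" using R(1)[OF z(1)] \<epsilon> by (intro mult_left_mono) auto
    ultimately have "v z \<le> \<epsilon> * R" by (simp add: v_def)
    also have "\<dots> < w x" using wx R by (simp add: \<epsilon>_def)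
    also have "\<dots> \<le> v x" using \<epsilon> by (simp add: v_def)
    finally show False using z(2)[OF x] by simp
  qed
  then have z\<Omega>: "z \<in> \<Omega>" using z \<Omega> by (simp add: frontier_def interior_open)
  obtain d where d: "0 < d" "ball z d \<subseteq> \<Omega>" using \<Omega> z\<Omega> by (meson open_contains_ball)
  have line: "z + t *\<^sub>R b \<in> \<Omega>" if "b \<in> Basis" "\<bar>t\<bar> < d" for b t
    using that d by (intro subsetD[OF d(2)]) (auto simp: dist_norm)
  have diff: "\<phi> differentiable (at y)" "\<psi> differentiable (at y)"
    "partial_deriv b \<phi> differentiable (at y)" "partial_deriv b \<psi> differentiable (at y)"
    if "y \<in> \<Omega>" "b \<in> Basis" for y b
    using \<phi>(2) \<psi>(2) that by (auto simp: harmonic_on_def C2_on_def)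
  have second: "partial_deriv b (partial_deriv b \<phi>) z - partial_deriv b (partial_deriv b \<psi>) z + 2 * \<epsilon> \<le> 0"
    if b: "b \<in> Basis" for b
  proof (rule second_derivative_nonpos_at_max[OF d(1)])
    show "((\<lambda>t. v (z + t *\<^sub>R b)) has_real_derivative
        partial_deriv b \<phi> (z + t *\<^sub>R b) - partial_deriv b \<psi> (z + t *\<^sub>R b) + \<epsilon> * (2 * (z \<bullet> b) + 2 * t)) (at t)"
      if t: "\<bar>t\<bar> < d" for t
    proof -
      have "(\<lambda>t. v (z + t *\<^sub>R b)) = (\<lambda>t. \<phi> (z + t *\<^sub>R b) - \<psi> (z + t *\<^sub>R b) + \<epsilon> * (z \<bullet> z + 2 * t * (z \<bullet> b) + t * t))"
        using b by (intro ext) (simp add: v_def w_def inner_add_left inner_add_right inner_commute algebra_simps)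
      then show ?thesis
        using differentiable_imp_line_derivative[OF diff(1)[OF line[OF b t] b]]
          differentiable_imp_line_derivative[OF diff(2)[OF line[OF b t] b]]
        by (auto intro!: derivative_eq_intros)
    qed
    have "((\<lambda>t. partial_deriv b \<phi> (z + t *\<^sub>R b)) has_real_derivative partial_deriv b (partial_deriv b \<phi>) z) (at 0)"
      "((\<lambda>t. partial_deriv b \<psi> (z + t *\<^sub>R b)) has_real_derivative partial_deriv b (partial_deriv b \<psi>) z) (at 0)"
      using differentiable_imp_line_derivative[of "partial_deriv b \<phi>" z 0 b]
        differentiable_imp_line_derivative[of "partial_deriv b \<psi>" z 0 b] diff(3,4)[OF z\<Omega> b] by simp_all
    then show "((\<lambda>t. partial_deriv b \<phi> (z + t *\<^sub>R b) - partial_deriv b \<psi> (z + t *\<^sub>R b) + \<epsilon> * (2 * (z \<bullet> b) + 2 * t))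
        has_real_derivative partial_deriv b (partial_deriv b \<phi>) z - partial_deriv b (partial_deriv b \<psi>) z + 2 * \<epsilon>) (at 0)"
      by (auto intro!: derivative_eq_intros)
    show "v (z + t *\<^sub>R b) \<le> v (z + 0 *\<^sub>R b)" if "\<bar>t\<bar> < d" for t
      using z(2) line[OF b that] closure_subset by auto
  qed
  have "laplacian \<phi> z - laplacian \<psi> z + 2 * \<epsilon> * real DIM('a) =
    (\<Sum>b\<in>Basis. partial_deriv b (partial_deriv b \<phi>) z - partial_deriv b (partial_deriv b \<psi>) z + 2 * \<epsilon>)"
    by (simp add: laplacian_def sum.distrib sum_subtractf)
  also have "\<dots> \<le> 0" using second by (intro sum_nonpos) auto
  finally have "\<epsilon> * real DIM('a) \<le> 0" using \<phi>(2) \<psi>(2) z\<Omega> by (simp add: harmonic_on_def)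
  moreover have "0 < \<epsilon> * real DIM('a)" using \<epsilon> by simp
  ultimately show False by linarith
qed

section \<open>Radial profile of the fundamental solution\<close>

definition fundamental_profile :: "'a::euclidean_space itself \<Rightarrow> real \<Rightarrow> real" where
  "fundamental_profile _ t =
     (let n = real DIM('a) in
      if DIM('a) = 2 then - ln t / (4 * pi)
      else t powr ((2 - n) / 2) / (n * (n - 2) * unit_ball_vol n))"

text \<open>With the squared distance as variable, both terms of the Green's function become one
  profile evaluated at polynomials in \<open>x\<close>, free of square roots.\<close>

lemma fundamental_solution_eq_profile:
  "fundamental_solution (z :: 'a::euclidean_space) = fundamental_profile TYPE('a) ((norm z)\<^sup>2)"
proof (cases "z = 0")
  \<comment> \<open>At the origin both sides take the default value 0.\<close>
  case True then show ?thesis by (simp add: fundamental_solution_def fundamental_profile_def Let_def)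
next
  case False
  have "((norm z)\<^sup>2) powr ((2 - real DIM('a)) / 2) = norm z powr (2 - real DIM('a))"
    using False by (simp add: powr_powr flip: powr_numeral) (simp add: diff_divide_distrib)
  then show ?thesis using False
    by (simp add: fundamental_solution_def fundamental_profile_def Let_def ln_realpow)
qed

lemma fundamental_profile_measurable [measurable]: "fundamental_profile TYPE('a::euclidean_space) \<in> borel_measurable borel"
  unfolding fundamental_profile_def [abs_def] Let_def by measurable

text \<open>Both branches share one derivative, because the unit disc has area \<open>pi\<close>.
  Arguments by derivatives then need no case split on the dimension.\<close>

lemma DERIV_fundamental_profile:
  assumes t: "0 < t"
  shows "(fundamental_profile TYPE('a::euclidean_space) has_real_derivative
      - (t powr (- real DIM('a) / 2) / (2 * real DIM('a) * unit_ball_vol DIM('a)))) (at t)"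
proof (cases "DIM('a) = 2")
  case True
  have "((\<lambda>t. - ln t / (4 * pi)) has_real_derivative - (t powr - 1 / (4 * pi))) (at t)"
    using t by (auto intro!: derivative_eq_intros simp: powr_minus divide_simps)
  then show ?thesis using True by (simp add: fundamental_profile_def [abs_def] unit_ball_vol_2)
next
  case False
  define n where "n = real DIM('a)"
  have n: "n \<noteq> 2" "0 < n" using False by (auto simp: n_def)
  have U: "unit_ball_vol n \<noteq> 0" using n by (simp add: unit_ball_vol_pos less_imp_neq[symmetric])
  have "((\<lambda>t. t powr ((2 - n) / 2) / (n * (n - 2) * unit_ball_vol n)) has_real_derivative
      ((2 - n) / 2 * t powr ((2 - n) / 2 - 1)) / (n * (n - 2) * unit_ball_vol n)) (at t)"
    using t n U by (auto intro!: derivative_eq_intros)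
  also have "(2 - n) / 2 - 1 = - n / 2" by (simp add: field_simps)
  also have "((2 - n) / 2 * t powr (- n / 2)) / (n * (n - 2) * unit_ball_vol n) =
     - (t powr (- n / 2) / (2 * n * unit_ball_vol n))"
    using n U by (simp add: divide_simps) (simp add: algebra_simps)
  finally show ?thesis using False by (simp add: fundamental_profile_def [abs_def] n_def Let_def)
qed

lemma fundamental_profile_antimono:
  assumes "0 < s" "s \<le> t"
  shows "fundamental_profile TYPE('a::euclidean_space) t \<le> fundamental_profile TYPE('a) s"
proof (rule DERIV_nonpos_imp_nonincreasing[OF assms(2)])
  fix x assume "s \<le> x" "x \<le> t"
  then have "0 < x" using assms by simp
  then show "\<exists>y. (fundamental_profile TYPE('a) has_real_derivative y) (at x) \<and> y \<le> 0"
    by (intro exI conjI, rule DERIV_fundamental_profile) (auto intro!: divide_nonneg_nonneg)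
qed

text \<open>This is 16 times the factor \<open>1 / (2 * n * unit_ball_vol n)\<close> in the
  derivative of the profile. The 16 pays for two factors 1/4: \<open>n / 2 - 1/4\<close> is at least
  1/4, and so is \<open>x powr (- (3/4))\<close> for \<open>x\<close> up to 4.\<close>

definition profile_bound :: "'a::euclidean_space itself \<Rightarrow> real" where
  "profile_bound _ = 8 / (real DIM('a) * unit_ball_vol DIM('a))"

text \<open>The exponent \<open>1/4 - n/2\<close> is not sharp; it is chosen so that one bound covers all dimensions,
  including the logarithmic case \<open>n = 2\<close>.\<close>
lemma fundamental_profile_le:
  assumes t: "0 < t" "t \<le> 4"
  shows "fundamental_profile TYPE('a::euclidean_space) t - fundamental_profile TYPE('a) 4
    \<le> profile_bound TYPE('a) * t powr (1/4 - real DIM('a) / 2)"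
proof -
  define n where "n = real DIM('a)"
  have n: "1 \<le> n" using DIM_positive[where 'a='a] by (simp add: n_def)
  define c where "c = 1 / (2 * n * unit_ball_vol n)"
  have c: "0 \<le> c" using n by (simp add: c_def)
  have C: "profile_bound TYPE('a) = 16 * c" by (simp add: profile_bound_def c_def n_def)
  let ?F = "fundamental_profile TYPE('a)"
  let ?H = "\<lambda>t. ?F t - 16 * c * t powr (1/4 - n / 2)"
  have "?H t \<le> ?H 4"
  proof (rule DERIV_nonneg_imp_nondecreasing[OF t(2)])
    fix x assume "t \<le> x" "x \<le> 4"
    then have x: "0 < x" "x \<le> 4" using t by auto
    have F: "(?F has_real_derivative - c * x powr (- n / 2)) (at x)"
      using DERIV_fundamental_profile[OF x(1), where 'a='a] by (simp add: c_def n_def)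
    have H: "(?H has_real_derivative - c * x powr (- n / 2) - 16 * c * ((1/4 - n / 2) * x powr (1/4 - n / 2 - 1))) (at x)"
      using x by (auto intro!: derivative_eq_intros F)
    have "1/4 \<le> x powr (- (3/4))"
    proof -
      have "(1/4::real) = 4 powr - 1" by (simp add: powr_minus)
      also have "\<dots> \<le> 4 powr (- (3/4))" by (intro powr_mono) auto
      also have "\<dots> \<le> x powr (- (3/4))" using x by (intro powr_mono2') auto
      finally show ?thesis .
    qed
    then have "1/4 * (1/4) \<le> (n / 2 - 1/4) * x powr (- (3/4))"
      using n by (intro mult_mono) auto
    then have "0 \<le> c * x powr (- n / 2) * (16 * ((n / 2 - 1/4) * x powr (- (3/4))) - 1)"
      using c by (intro mult_nonneg_nonneg) auto
    also have "\<dots> = - c * x powr (- n / 2) - 16 * c * ((1/4 - n / 2) * (x powr (- n / 2) * x powr (- (3/4))))"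
      by (simp add: algebra_simps)
    also have "x powr (- n / 2) * x powr (- (3/4)) = x powr (1/4 - n / 2 - 1)"
      by (simp add: algebra_simps flip: powr_add)
    finally show "\<exists>y. (?H has_real_derivative y) (at x) \<and> 0 \<le> y" using H by blast
  qed
  moreover have "0 \<le> 16 * c * 4 powr (1/4 - n / 2)" using c by simp
  ultimately show ?thesis by (simp add: C n_def)
qed

section \<open>Mirror image and corrector\<close>

text \<open>The squared norm of \<open>\<bar>y\<bar> x - y / \<bar>y\<bar>\<close>, i.e. of \<open>\<bar>y\<bar>\<close> times the distance from \<open>x\<close> to the
  mirror image of \<open>y\<close> in the unit sphere.\<close>
definition mirror_dist2 :: "'a::real_inner \<Rightarrow> 'a \<Rightarrow> real" where
  "mirror_dist2 y x = (y \<bullet> y) * (x \<bullet> x) - 2 * (x \<bullet> y) + 1"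

text \<open>On the unit sphere the last product vanishes, which gives the corrector its boundary
  values; inside the ball it is nonnegative, which gives the Green's function its sign.\<close>

lemma mirror_dist2_eq: "mirror_dist2 y x = (norm (x - y))\<^sup>2 + (1 - (norm x)\<^sup>2) * (1 - (norm y)\<^sup>2)"
  by (simp add: mirror_dist2_def power2_norm_eq_inner inner_diff_left inner_diff_right inner_commute algebra_simps)

lemma norm_diff_le_mirror_dist2:
  assumes "norm x \<le> 1" "norm y \<le> 1"
  shows "(norm (x - y))\<^sup>2 \<le> mirror_dist2 y x"
  using assms by (simp add: mirror_dist2_eq power_le_one)

lemma mirror_dist2_pos:
  fixes x y :: "'a::real_inner"
  assumes "norm x \<le> 1" "norm y < 1"
  shows "0 < mirror_dist2 y x"
proof (cases "x = y")
  case True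
  have "(norm y)\<^sup>2 < 1" using assms by (simp add: power_less_one_iff)
  then show ?thesis using True by (simp add: mirror_dist2_eq)
next
  case False
  then have "0 < (norm (x - y))\<^sup>2" by simp
  then show ?thesis using norm_diff_le_mirror_dist2[of x y] assms by linarith
qed

lemma mirror_dist2_le_4:
  assumes "norm x \<le> 1" "norm y \<le> 1"
  shows "mirror_dist2 y x \<le> 4"
proof -
  have "\<bar>x \<bullet> y\<bar> \<le> 1 * 1"
    using Cauchy_Schwarz_ineq2[of x y] mult_mono[OF assms] by simp
  moreover have "(y \<bullet> y) * (x \<bullet> x) \<le> 1 * 1"
    using assms by (intro mult_mono) (auto simp: power_le_one simp flip: power2_norm_eq_inner)
  ultimately show ?thesis by (simp add: mirror_dist2_def)
qed

lemma continuous_on_mirror_dist2 [continuous_intros]: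
  "continuous_on A (mirror_dist2 y)"
  unfolding mirror_dist2_def [abs_def] by (intro continuous_intros)

lemma partial_deriv_eqI: "(u has_derivative u') (at x) \<Longrightarrow> partial_deriv b u x = u' b"
  by (simp add: partial_deriv_def frechet_derivative_at[symmetric])

text \<open>With \<open>a = y \<bullet> y\<close>, the polynomial \<open>q = mirror_dist2 y\<close>
  has Laplacian \<open>2 * n * a\<close> and gradient of squared length \<open>4 * a * q\<close>.
  These are the proportions for which the two terms in the Laplacian of the profile at
  \<open>q\<close> cancel. Since the reflected point itself never appears, the pole
  \<open>y = 0\<close> is covered too.\<close>

lemma harmonic_on_profile_mirror_dist2:
  fixes y :: "'a::euclidean_space"
  shows "harmonic_on {x. 0 < mirror_dist2 y x} (\<lambda>x. fundamental_profile TYPE('a) (mirror_dist2 y x))"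
proof -
  define n where "n = real DIM('a)"
  define c where "c = 1 / (2 * n * unit_ball_vol n)"
  define a where "a = y \<bullet> y"
  let ?q = "mirror_dist2 y"
  let ?u = "\<lambda>x. fundamental_profile TYPE('a) (?q x)"
  define U where "U = {x. 0 < ?q x}"
  have U: "open U" unfolding U_def by (intro open_Collect_less continuous_on_const continuous_on_mirror_dist2)
  have q: "(?q has_derivative (\<lambda>h. 2 * a * (x \<bullet> h) - 2 * (h \<bullet> y))) (at x)" for x
    unfolding mirror_dist2_def [abs_def] a_def
    by (auto intro!: derivative_eq_intros simp: inner_commute algebra_simps)
  have powr_q: "((\<lambda>x. ?q x powr r) has_derivative (\<lambda>h. r * ?q x powr (r - 1) * (2 * a * (x \<bullet> h) - 2 * (h \<bullet> y)))) (at x)"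
    if "x \<in> U" for x r
  proof -
    have "((\<lambda>t. t powr r) has_real_derivative r * ?q x powr (r - 1)) (at (?q x))"
      using that by (intro has_real_derivative_powr) (simp add: U_def)
    from has_derivative_compose[OF q this[unfolded has_field_derivative_def]]
    show ?thesis by simp
  qed
  have u: "(?u has_derivative (\<lambda>h. - c * ?q x powr (- n / 2) * (2 * a * (x \<bullet> h) - 2 * (h \<bullet> y)))) (at x)"
    if "x \<in> U" for x
  proof -
    have "(fundamental_profile TYPE('a) has_real_derivative - c * ?q x powr (- n / 2)) (at (?q x))"
      using DERIV_fundamental_profile[of "?q x", where 'a='a] that by (simp add: U_def c_def n_def)
    from has_derivative_compose[OF q this[unfolded has_field_derivative_def]]
    show ?thesis by simp
  qed
  have pu: "partial_deriv b ?u x = - c * ?q x powr (- n / 2) * (2 * a * (x \<bullet> b) - 2 * (b \<bullet> y))"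
    if "x \<in> U" for b x
    using partial_deriv_eqI[OF u[OF that]] .
  have ppu: "(partial_deriv b ?u has_derivative
      (\<lambda>h. - c * ?q x powr (- n / 2) * (2 * a * (h \<bullet> b)) +
           - c * (- n / 2 * ?q x powr (- n / 2 - 1) * (2 * a * (x \<bullet> h) - 2 * (h \<bullet> y))) * (2 * a * (x \<bullet> b) - 2 * (b \<bullet> y)))) (at x)"
    if x: "x \<in> U" for b x
  proof (rule has_derivative_transform_within_open[OF _ U x])
    show "((\<lambda>x. - c * ?q x powr (- n / 2) * (2 * a * (x \<bullet> b) - 2 * (b \<bullet> y))) has_derivative
      (\<lambda>h. - c * ?q x powr (- n / 2) * (2 * a * (h \<bullet> b)) +
           - c * (- n / 2 * ?q x powr (- n / 2 - 1) * (2 * a * (x \<bullet> h) - 2 * (h \<bullet> y))) * (2 * a * (x \<bullet> b) - 2 * (b \<bullet> y)))) (at x)"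
      by (rule derivative_eq_intros powr_q[OF x] refl)+ (simp add: algebra_simps)
  qed (simp add: pu)
  have pp: "partial_deriv d (partial_deriv b ?u) x =
      - c * ?q x powr (- n / 2) * (2 * a * (d \<bullet> b)) +
           - c * (- n / 2 * ?q x powr (- n / 2 - 1) * (2 * a * (x \<bullet> d) - 2 * (d \<bullet> y))) * (2 * a * (x \<bullet> b) - 2 * (b \<bullet> y))"
    if "x \<in> U" for b d x
    using partial_deriv_eqI[OF ppu[OF that]] .
  have "C2_on U ?u"
    unfolding C2_on_def
  proof (intro conjI ballI)
    show "?u differentiable (at x)" if "x \<in> U" for x
      using u[OF that] by (rule differentiableI)
    show "partial_deriv b ?u differentiable (at x)" if "x \<in> U" for b x
      using ppu[OF that] by (rule differentiableI)
    show "continuous_on U (partial_deriv d (partial_deriv b ?u))" for b d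
    proof (rule continuous_on_eq)
      show "continuous_on U (\<lambda>x. - c * ?q x powr (- n / 2) * (2 * a * (d \<bullet> b)) +
           - c * (- n / 2 * ?q x powr (- n / 2 - 1) * (2 * a * (x \<bullet> d) - 2 * (d \<bullet> y))) * (2 * a * (x \<bullet> b) - 2 * (b \<bullet> y)))"
        by (intro continuous_intros) (auto simp: U_def)
    qed (simp add: pp)
  qed
  moreover have "laplacian ?u x = 0" if x: "x \<in> U" for x
  proof -
    have q0: "0 < ?q x" using x by (simp add: U_def)
    have "(\<Sum>b\<in>Basis. (2 * a * (x \<bullet> b) - 2 * (b \<bullet> y))\<^sup>2) = 4 * (\<Sum>b\<in>Basis. ((a *\<^sub>R x - y) \<bullet> b) * ((a *\<^sub>R x - y) \<bullet> b))"
      unfolding sum_distrib_left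
      by (intro sum.cong) (auto simp: inner_diff_left inner_commute power2_eq_square algebra_simps)
    also have "(\<Sum>b\<in>Basis. ((a *\<^sub>R x - y) \<bullet> b) * ((a *\<^sub>R x - y) \<bullet> b)) = (a *\<^sub>R x - y) \<bullet> (a *\<^sub>R x - y)"
      by (rule euclidean_inner[symmetric])
    also have "\<dots> = a * ?q x"
      by (simp add: mirror_dist2_def inner_diff_left inner_diff_right inner_commute algebra_simps flip: a_def)
    finally have S: "(\<Sum>b\<in>Basis. (2 * a * (x \<bullet> b) - 2 * (b \<bullet> y))\<^sup>2) = 4 * (a * ?q x)" .
    have "?q x powr (- n / 2) = ?q x powr (- n / 2 - 1) * ?q x"
      using q0 by (simp add: powr_diff)
    then have P: "?q x * ?q x powr (- n / 2 - 1) = ?q x powr (- n / 2)" by simp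
    have lin: "(\<Sum>b\<in>(Basis::'a set). A + B * f b) = n * A + B * sum f Basis" for A B :: real and f
      by (simp add: sum.distrib n_def sum_distrib_left)
    have "laplacian ?u x = (\<Sum>b\<in>Basis. - c * ?q x powr (- n / 2) * (2 * a) +
           c * (n / 2) * ?q x powr (- n / 2 - 1) * (2 * a * (x \<bullet> b) - 2 * (b \<bullet> y))\<^sup>2)"
      unfolding laplacian_def by (intro sum.cong) (auto simp: pp[OF x] power2_eq_square)
    also have "\<dots> = n * (- c * ?q x powr (- n / 2) * (2 * a)) +
           c * (n / 2) * ?q x powr (- n / 2 - 1) * (4 * (a * ?q x))"
      by (simp only: lin S)
    also have "\<dots> = 2 * n * c * a * (?q x * ?q x powr (- n / 2 - 1) - ?q x powr (- n / 2))"
      by (simp add: algebra_simps)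
    finally show ?thesis unfolding P by simp
  qed
  ultimately show ?thesis by (simp add: harmonic_on_def U_def)
qed

lemma harmonic_on_subset: "harmonic_on T u \<Longrightarrow> S \<subseteq> T \<Longrightarrow> harmonic_on S u"
  unfolding harmonic_on_def C2_on_def by (meson continuous_on_subset subsetD)

text \<open>The value on the diagonal is irrelevant for the integrals.\<close>
definition green_ball :: "'a::euclidean_space \<Rightarrow> 'a \<Rightarrow> real" where
  "green_ball x y = (if x = y then 0 else
     fundamental_profile TYPE('a) ((norm (x - y))\<^sup>2) - fundamental_profile TYPE('a) (mirror_dist2 y x))"

text \<open>The definition only provides some corrector; the maximum principle identifies it with
  the profile at \<open>mirror_dist2 y\<close>. The diagonal is excluded because \<open>k\<close> is
  unspecified there.\<close>

lemma dirichlet_green_function_ball: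
  fixes k :: "'a::euclidean_space \<Rightarrow> 'a \<Rightarrow> real"
  assumes k: "dirichlet_green_function (ball 0 1) k" and x: "x \<in> cball 0 1" and y: "y \<in> ball 0 1" and "x \<noteq> y"
  shows "k x y = green_ball x y"
proof -
  obtain \<phi> where \<phi>: "continuous_on (closure (ball 0 1)) \<phi>" "harmonic_on (ball 0 1) \<phi>"
    "\<And>x. x \<in> frontier (ball 0 1) \<Longrightarrow> \<phi> x = fundamental_solution (x - y)"
    "\<And>x. x \<in> closure (ball 0 1) - {y} \<Longrightarrow> k x y = fundamental_solution (x - y) - \<phi> x"
    using k y unfolding dirichlet_green_function_def by blast
  define \<psi> where "\<psi> x = fundamental_profile TYPE('a) (mirror_dist2 y x)" for x
  have pos: "0 < mirror_dist2 y x" if "x \<in> cball 0 1" for x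
    using that y by (intro mirror_dist2_pos) auto
  have h: "harmonic_on (ball 0 1) \<psi>"
    unfolding \<psi>_def [abs_def] using pos by (intro harmonic_on_subset[OF harmonic_on_profile_mirror_dist2]) auto
  have "continuous_on {0<..} (fundamental_profile TYPE('a))"
    by (rule DERIV_continuous_on[OF has_field_derivative_at_within[OF DERIV_fundamental_profile]]) auto
  from continuous_on_compose2[OF this continuous_on_mirror_dist2[of "cball 0 1" y]]
  have c: "continuous_on (closure (ball 0 1)) \<psi>"
    unfolding \<psi>_def [abs_def] using pos by (simp add: image_subset_iff)
  \<comment> \<open>For \<open>norm z = 1\<close> the mirror distance and the distance to
    \<open>y\<close> coincide.\<close>
  have bd: "\<phi> z = \<psi> z" if "z \<in> frontier (ball 0 1)" for z
    using \<phi>(3)[OF that] that by (simp add: \<psi>_def mirror_dist2_eq fundamental_solution_eq_profile)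
  have xc: "x \<in> closure (ball 0 1)" using x by simp
  have "\<phi> x \<le> \<psi> x" "\<psi> x \<le> \<phi> x"
    using harmonic_on_le[OF open_ball bounded_ball \<phi>(1,2) c h _ xc]
      harmonic_on_le[OF open_ball bounded_ball c h \<phi>(1,2) _ xc] bd by auto
  then show ?thesis using \<phi>(4)[of x] xc \<open>x \<noteq> y\<close>
    by (simp add: green_ball_def \<psi>_def fundamental_solution_eq_profile)
qed

lemma green_ball_nonneg:
  assumes "norm x \<le> 1" "norm y \<le> 1"
  shows "0 \<le> green_ball x y"
  using fundamental_profile_antimono[of "(norm (x - y))\<^sup>2" "mirror_dist2 y x", where 'a='a]
    norm_diff_le_mirror_dist2[OF assms] by (simp add: green_ball_def)

text \<open>Both squared distances are at most 4, so by monotonicity the corrector may be replaced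
  by the constant value of the profile at 4. The resulting exponent lies above
  \<open>- real DIM('a)\<close>, hence is integrable at the origin.\<close>

lemma green_ball_le:
  fixes x y :: "'a::euclidean_space"
  assumes "norm x \<le> 1" "norm y \<le> 1"
  shows "green_ball x y \<le> profile_bound TYPE('a) * norm (x - y) powr (- (real DIM('a) - 1/2))"
proof (cases "x = y")
  case False
  let ?F = "fundamental_profile TYPE('a)"
  have r: "0 < (norm (x - y))\<^sup>2" using False by simp
  have q: "(norm (x - y))\<^sup>2 \<le> mirror_dist2 y x" "mirror_dist2 y x \<le> 4"
    using norm_diff_le_mirror_dist2[OF assms] mirror_dist2_le_4[OF assms] by auto
  have "green_ball x y \<le> ?F ((norm (x - y))\<^sup>2) - ?F 4"
    using fundamental_profile_antimono[of "mirror_dist2 y x" 4, where 'a='a] r q False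
    by (simp add: green_ball_def)
  also have "\<dots> \<le> profile_bound TYPE('a) * ((norm (x - y))\<^sup>2) powr (1/4 - real DIM('a) / 2)"
    using r q by (intro fundamental_profile_le) auto
  also have "((norm (x - y))\<^sup>2) powr (1/4 - real DIM('a) / 2) = norm (x - y) powr (- (real DIM('a) - 1/2))"
  proof -
    have "((norm (x - y))\<^sup>2) = norm (x - y) powr 2" using False by simp
    then show ?thesis by (simp only: powr_powr) (simp add: algebra_simps)
  qed
  finally show ?thesis .
qed (simp add: green_ball_def)

lemma isCont_green_ball:
  fixes x y :: "'a::euclidean_space"
  assumes "norm x \<le> 1" "norm y < 1" "x \<noteq> y"
  shows "isCont (\<lambda>x. green_ball x y) x"
proof -
  define U where "U = - {y} \<inter> {x. 0 < mirror_dist2 y x}"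
  have U: "open U" unfolding U_def
    by (intro open_Int open_Collect_less continuous_on_const continuous_on_mirror_dist2) auto
  have F: "continuous_on {0<..} (fundamental_profile TYPE('a))"
    by (rule DERIV_continuous_on[OF has_field_derivative_at_within[OF DERIV_fundamental_profile]]) auto
  have "continuous_on U (\<lambda>x. fundamental_profile TYPE('a) ((norm (x - y))\<^sup>2) - fundamental_profile TYPE('a) (mirror_dist2 y x))"
    by (intro continuous_intros continuous_on_compose2[OF F]) (auto simp: U_def)
  then have "continuous_on U (\<lambda>x. green_ball x y)"
    by (rule continuous_on_eq) (auto simp: green_ball_def U_def)
  moreover have "x \<in> U" using assms mirror_dist2_pos[of x y] by (auto simp: U_def)
  ultimately show ?thesis using U continuous_on_eq_continuous_at by blast
qed

section \<open>Measurability and integrability\<close>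

lemma green_ball_measurable: "green_ball x \<in> borel_measurable borel"
proof -
  have [measurable]: "(\<lambda>y. mirror_dist2 y x) \<in> borel_measurable borel"
    unfolding mirror_dist2_def by (intro borel_measurable_continuous_onI continuous_intros)
  show ?thesis unfolding green_ball_def [abs_def] by measurable
qed

text \<open>Dyadic shells take the place of polar coordinates: on the shell of outer radius
  \<open>R * (1/2)^j\<close> the power is at most its value \<open>M j\<close> at the inner radius.
  The shells contribute a geometric series with ratio \<open>2 powr (a - N) < 1\<close>.\<close>

lemma integrable_norm_powr_ball:
  fixes a R :: real
  assumes a: "0 \<le> a" "a < DIM('a)" and R: "0 < R"
  shows "integrable lborel (\<lambda>z::'a::euclidean_space. indicator (ball 0 R) z * norm z powr (- a))"
proof (rule integrableI_bounded)
  define N where "N = real DIM('a)"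
  define B where "B j = ball (0::'a) (R * (1/2)^j)" for j :: nat
  define M where "M j = (R * (1/2)^Suc j) powr (- a)" for j :: nat
  let ?h = "\<lambda>z::'a. indicator (ball 0 R) z * norm z powr (- a)"
  have pt: "ennreal (norm (?h z)) \<le> (\<Sum>j. ennreal (M j) * indicator (B j) z)" for z
  proof (cases "z \<in> ball 0 R \<and> z \<noteq> 0")
    \<comment> \<open>The origin causes no trouble, because \<open>0 powr (- a)\<close> is
      0.\<close>
    case False
    then have "ennreal (norm (?h z)) = 0" by auto
    then show ?thesis by (simp only: zero_le)
  next
    case True
    define P where "P j \<longleftrightarrow> R * (1/2)^Suc j \<le> norm z" for j :: nat
    have lim: "(\<lambda>j. R * (1/2)^Suc j) \<longlonglongrightarrow> R * 0"
      by (intro tendsto_intros LIMSEQ_Suc LIMSEQ_power_zero) auto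
    have "eventually (\<lambda>j. R * (1/2)^Suc j < norm z) sequentially"
      using order_tendstoD(2)[OF lim, of "norm z"] True by simp
    then obtain j0 where "P j0" using less_imp_le by (auto simp: eventually_sequentially P_def)
    \<comment> \<open>The least such \<open>j\<close> indexes the shell of \<open>z\<close>: its
      inner radius is at most \<open>norm z\<close>, and minimality puts \<open>z\<close> inside the
      outer one.\<close>
    define j where "j = (LEAST j. P j)"
    have Pj: "P j" unfolding j_def by (rule LeastI) fact
    have zB: "z \<in> B j"
    proof (cases j)
      case 0 then show ?thesis using True by (simp add: B_def)
    next
      case (Suc i)
      then have "\<not> P i" using not_less_Least[of i P] by (simp add: j_def)
      then show ?thesis by (simp add: B_def P_def Suc)
    qed
    have "norm (?h z) = norm z powr (- a)" using True by simp
    also have "\<dots> \<le> M j" unfolding M_def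
      using Pj R a by (intro powr_mono2') (auto simp: P_def)
    finally have *: "ennreal (norm (?h z)) \<le> ennreal (M j) * indicator (B j) z"
      using zB by (simp add: ennreal_leI)
    define F where "F i = ennreal (M i) * indicator (B i) z" for i
    have "F j = sum F {j}" by simp
    also have "\<dots> \<le> suminf F"
      by (rule sum_le_suminf) auto
    finally show ?thesis using * unfolding F_def by (rule order_trans[rotated])
  qed
  have B_sets [measurable]: "B j \<in> sets borel" for j by (simp add: B_def)
  have shell: "ennreal (M j) * emeasure lborel (B j) =
      ennreal ((R/2) powr (- a) * unit_ball_vol N * R powr N * (2 powr (a - N)) ^ j)" for j
  proof -
    have 1: "M j = (R/2) powr (- a) * (2 powr a) ^ j"
    proof -
      have "M j = (R/2 * 2 powr (- real j)) powr (- a)"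
        by (simp add: M_def powr_minus powr_realpow power_one_over inverse_eq_divide)
      also have "\<dots> = (R/2) powr (- a) * 2 powr (real j * a)"
        using R by (subst powr_mult) (simp_all add: powr_powr)
      also have "2 powr (real j * a) = (2 powr a) ^ j"
        by (simp add: powr_powr mult.commute flip: powr_realpow)
      finally show ?thesis .
    qed
    have 2: "(R * (1/2)^j) ^ DIM('a) = R powr N * (2 powr (- N)) ^ j"
    proof -
      have "(R * (1/2)^j) ^ DIM('a) = (R * 2 powr (- real j)) powr N"
        using R by (simp add: N_def powr_realpow powr_minus power_one_over inverse_eq_divide)
      also have "\<dots> = R powr N * 2 powr (- (real j * N))"
        using R by (simp add: powr_mult powr_powr)
      also have "2 powr (- (real j * N)) = (2 powr (- N)) ^ j"
        by (simp add: powr_powr mult.commute flip: powr_realpow)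
      finally show ?thesis .
    qed
    have "ennreal (M j) * emeasure lborel (B j) = ennreal (M j * (unit_ball_vol N * (R * (1/2)^j) ^ DIM('a)))"
      using R by (simp add: B_def emeasure_ball N_def ennreal_mult' M_def)
    also have "M j * (unit_ball_vol N * (R * (1/2)^j) ^ DIM('a)) =
       (R/2) powr (- a) * unit_ball_vol N * R powr N * (2 powr (a - N)) ^ j"
      unfolding 1 2 by (simp add: powr_add[of 2 a "- N", simplified] power_mult_distrib)
    finally show ?thesis .
  qed
  have "(\<integral>\<^sup>+z. ennreal (norm (?h z)) \<partial>lborel) \<le> (\<integral>\<^sup>+z. (\<Sum>j. ennreal (M j) * indicator (B j) z) \<partial>lborel)"
    by (rule nn_integral_mono) (rule pt)
  also have "\<dots> = (\<Sum>j. (\<integral>\<^sup>+z. ennreal (M j) * indicator (B j) z \<partial>lborel))"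
    by (rule nn_integral_suminf) measurable
  also have "\<dots> = (\<Sum>j. ennreal (M j) * emeasure lborel (B j))"
    by (simp add: nn_integral_cmult_indicator)
  also have "\<dots> < \<infinity>"
  proof -
    have r: "2 powr (a - N) < 1" using a by (simp add: N_def powr_less_one)
    have "summable (\<lambda>j. (R/2) powr (- a) * unit_ball_vol N * R powr N * (2 powr (a - N)) ^ j)"
      using r by (intro summable_mult summable_geometric) auto
    then show ?thesis unfolding shell
      by (subst suminf_ennreal2) (auto simp: N_def)
  qed
  finally show "(\<integral>\<^sup>+z. ennreal (norm (?h z)) \<partial>lborel) < \<infinity>" .
  show "?h \<in> borel_measurable lborel"
    by (intro borel_measurable_times borel_measurable_indicator) (simp_all add: powr_def)
qed

text \<open>Measurability of \<open>h\<close> is a consequence: it is \<open>h'\<close> altered at a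
  single point. This absorbs the unspecified values of \<open>k\<close> on the diagonal.\<close>

lemma integral_cong_off_point:
  fixes h h' :: "'a::euclidean_space \<Rightarrow> real"
  assumes h': "h' \<in> borel_measurable borel" and eq: "\<And>y. y \<noteq> x \<Longrightarrow> h y = h' y"
  shows "(\<integral>y. h y \<partial>lborel) = (\<integral>y. h' y \<partial>lborel)"
proof (rule integral_cong_AE)
  have "h = (\<lambda>y. if y = x then h x else h' y)" using eq by auto
  also have "\<dots> \<in> borel_measurable borel" using h' by measurable
  finally show "h \<in> borel_measurable lborel" by simp
  show "AE y in lborel. h y = h' y"
    using AE_lborel_singleton[of x] by eventually_elim (rule eq)
qed (use h' in simp)

section \<open>Green potentials as values of the integral operator\<close>

definition green_kernel :: "'a::euclidean_space \<Rightarrow> 'a \<Rightarrow> real" where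
  "green_kernel x y = indicator (ball 0 1) y * green_ball x y"

text \<open>Radius 2 contains every difference \<open>x - y\<close> with \<open>x\<close> in the
  closed and \<open>y\<close> in the open unit ball.\<close>

definition green_majorant :: "'a::euclidean_space \<Rightarrow> real" where
  "green_majorant z = profile_bound TYPE('a) * (indicator (ball 0 2) z * norm z powr (- (real DIM('a) - 1/2)))"

interpretation ball: compact_kernel "cball 0 1" "ball 0 1" green_kernel "green_majorant :: 'a::euclidean_space \<Rightarrow> real"
proof unfold_locales
  \<comment> \<open>Dimension at least 1 makes \<open>real DIM('a) - 1/2\<close> nonnegative, so
    that the integrability lemma applies.\<close>
  have DIM: "1 \<le> real DIM('a)" using DIM_positive[where 'a='a] by (simp add: Suc_le_eq)
  show "integrable lborel (green_majorant :: 'a \<Rightarrow> real)"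
    unfolding green_majorant_def [abs_def]
    by (intro integrable_mult_right integrable_norm_powr_ball) (use DIM in linarith)+
  fix x y :: 'a assume x: "x \<in> cball 0 1"
  show "green_kernel x \<in> borel_measurable borel"
    unfolding green_kernel_def [abs_def]
    by (intro borel_measurable_times borel_measurable_indicator green_ball_measurable) simp
  show "0 \<le> green_kernel x y"
    using x green_ball_nonneg[of x y] by (simp add: green_kernel_def indicator_def)
  show "green_kernel x y \<le> green_majorant (x - y)"
  proof (cases "y \<in> ball 0 1")
    case True
    then have "norm (x - y) < 2" using x norm_triangle_ineq4[of x y] by simp
    then show ?thesis using x True green_ball_le[of x y] by (simp add: green_kernel_def green_majorant_def)
  qed (simp add: green_kernel_def green_majorant_def profile_bound_def)
  show "AE y in lborel. continuous (at x within cball 0 1) (\<lambda>x. green_kernel x y)"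
    using AE_lborel_singleton[of x]
  proof eventually_elim
    case (elim y)
    show ?case
    proof (cases "y \<in> ball 0 1")
      case True
      then have "isCont (\<lambda>x. green_ball x y) x" using x elim by (intro isCont_green_ball) auto
      then show ?thesis using True by (simp add: green_kernel_def continuous_at_imp_continuous_within)
    qed (simp add: green_kernel_def)
  qed
qed (auto simp: green_kernel_def emeasure_ball)

text \<open>Passage from the given \<open>k\<close> to the abstract operator. Agreement of the
  densities on the open ball suffices, because the integral sees nothing else.\<close>

lemma green_potential_eq:
  fixes k :: "'a::euclidean_space \<Rightarrow> 'a \<Rightarrow> real"
  assumes k: "dirichlet_green_function (ball 0 1) k" and x: "x \<in> cball 0 1"
    and h: "\<And>y. y \<in> ball 0 1 \<Longrightarrow> h y = apply_bcontfun h' y"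
  shows "(LINT y:ball 0 1|lborel. k x y * h y) = apply_bcontfun (ball.integral_op h') x"
proof -
  have "(LINT y:ball 0 1|lborel. k x y * h y) = (\<integral>y. green_kernel x y * apply_bcontfun h' y \<partial>lborel)"
    unfolding set_lebesgue_integral_def
  proof (rule integral_cong_off_point[where x = x])
    have "apply_bcontfun h' \<in> borel_measurable borel" by (intro borel_measurable_continuous_onI) simp
    then show "(\<lambda>y. green_kernel x y * apply_bcontfun h' y) \<in> borel_measurable borel"
      using ball.k_measurable[OF x] by simp
    show "indicator (ball 0 1) y *\<^sub>R (k x y * h y) = green_kernel x y * apply_bcontfun h' y" if "y \<noteq> x" for y
      using dirichlet_green_function_ball[OF k x, of y] h[of y] that
      by (cases "y \<in> ball 0 1") (auto simp: green_kernel_def)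
  qed
  then show ?thesis using closest_point_self[OF x] by simp
qed

text \<open>Turns positivity of a supremum into positivity at one point, the form in which it bounds
  the norms of potentials from below.\<close>

lemma green_potential_pos_point:
  fixes k :: "'a::euclidean_space \<Rightarrow> 'a \<Rightarrow> real"
  assumes k: "dirichlet_green_function (ball 0 1) k"
    and h: "continuous_on (cball 0 1) h"
    and pos: "0 < (SUP x\<in>cball 0 1. LINT y:ball 0 1|lborel. k x y * h y)"
  obtains h' a where "\<And>x. apply_bcontfun h' x = h (closest_point (cball 0 1) x)"
    "0 < apply_bcontfun (ball.integral_op h') (a::'a)"
proof -
  obtain b where b: "\<And>x. x \<in> cball 0 1 \<Longrightarrow> norm (h x) \<le> b"
    using compact_imp_bounded[OF compact_continuous_image[OF h compact_cball]] unfolding bounded_iff by blast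
  define h' where "h' = Bcontfun (\<lambda>x. h (closest_point (cball 0 1) x))"
  have "(\<lambda>x. h (closest_point (cball 0 1) x)) \<in> bcontfun"
    using ball.proj_in b
    by (intro bcontfun_normI[where b = b] continuous_on_compose2[OF h ball.continuous_on_proj]) blast+
  then have h': "apply_bcontfun h' x = h (closest_point (cball 0 1) x)" for x
    by (simp add: h'_def Bcontfun_inverse)
  have eq: "(LINT y:ball 0 1|lborel. k x y * h y) = apply_bcontfun (ball.integral_op h') x"
    if "x \<in> cball 0 1" for x
    using k that by (rule green_potential_eq) (simp add: h' closest_point_self)
  have "0 < (SUP x\<in>cball 0 1. apply_bcontfun (ball.integral_op h') x)"
    using pos eq by (simp cong: SUP_cong_simp del: ball.integral_op_apply)
  \<comment> \<open>Boundedness above is what gives the real supremum its order-theoretic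
    meaning.\<close>
  moreover have "bdd_above (apply_bcontfun (ball.integral_op h') ` cball 0 1)"
    by (rule bdd_aboveI2[where M = "norm (ball.integral_op h')"])
       (use norm_bounded[of "ball.integral_op h'"] in \<open>auto simp del: ball.integral_op_apply intro: order_trans[OF abs_ge_self]\<close>)
  ultimately obtain a where "0 < apply_bcontfun (ball.integral_op h') (a::'a)"
    by (subst (asm) less_cSUP_iff) auto
  with h' show ?thesis by (rule that)
qed

section \<open>The system of integral equations\<close>

text \<open>A function that factors through a map into \<open>K\<close> takes all its values on
  \<open>K\<close>, so the norm on the whole space is the norm of the restriction.\<close>

lemma max_norm_eq_norm:
  fixes u :: "'a::topological_space \<Rightarrow>\<^sub>C real"
  assumes "\<And>x. p x \<in> K \<and> apply_bcontfun u x = apply_bcontfun u (p x)"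
  shows "max_norm K (apply_bcontfun u) = norm u"
proof (rule antisym)
  have bdd: "bdd_above ((\<lambda>x. \<bar>apply_bcontfun u x\<bar>) ` K)"
    using norm_bounded[of u] by (intro bdd_aboveI2) auto
  have "K \<noteq> {}" using assms by blast
  then show "max_norm K (apply_bcontfun u) \<le> norm u"
    unfolding max_norm_def using norm_bounded[of u] by (intro cSUP_least) auto
  show "norm u \<le> max_norm K (apply_bcontfun u)"
  proof (rule norm_bound)
    fix x
    have "\<bar>apply_bcontfun u (p x)\<bar> \<le> max_norm K (apply_bcontfun u)"
      unfolding max_norm_def using assms[of x] by (intro cSUP_upper bdd) blast
    then show "norm (apply_bcontfun u x) \<le> max_norm K (apply_bcontfun u)" using assms[of x] by simp
  qed
qed

theorem theorem3p1:
  fixes \<Omega> :: "'a::euclidean_space set"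
    and k :: "'a \<Rightarrow> 'a \<Rightarrow> real"
    and f g :: "'a \<Rightarrow> real \<Rightarrow> real \<Rightarrow> real"
    and f_low g_low :: "'a \<Rightarrow> real"
    and r1 r2 :: real
  assumes \<Omega>: "\<Omega> = ball 0 1"
    and k: "dirichlet_green_function \<Omega> k"
    and f_cont: "continuous_on (closure \<Omega> \<times> {0..} \<times> {0..}) (\<lambda>(x, u, v). f x u v)"
    and f_nonneg: "\<And>x u v. x \<in> closure \<Omega> \<Longrightarrow> 0 \<le> u \<Longrightarrow> 0 \<le> v \<Longrightarrow> 0 \<le> f x u v"
    and g_cont: "continuous_on (closure \<Omega> \<times> {0..} \<times> {0..}) (\<lambda>(x, u, v). g x u v)"
    and g_nonneg: "\<And>x u v. x \<in> closure \<Omega> \<Longrightarrow> 0 \<le> u \<Longrightarrow> 0 \<le> v \<Longrightarrow> 0 \<le> g x u v"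
    and r: "0 < r1" "0 < r2"
    and f_low_cont: "continuous_on (closure \<Omega>) f_low"
    and f_low_nonneg: "\<And>x. x \<in> closure \<Omega> \<Longrightarrow> 0 \<le> f_low x"
    and g_low_cont: "continuous_on (closure \<Omega>) g_low"
    and g_low_nonneg: "\<And>x. x \<in> closure \<Omega> \<Longrightarrow> 0 \<le> g_low x"
    and f_lower: "\<And>x u v. x \<in> closure \<Omega> \<Longrightarrow> u \<in> {0..r1} \<Longrightarrow> v \<in> {0..r2} \<Longrightarrow> f_low x \<le> f x u v"
    and f_low_pos: "0 < (SUP x\<in>closure \<Omega>. LINT y:\<Omega>|lborel. k x y * f_low y)"
    and g_lower: "\<And>x u v. x \<in> closure \<Omega> \<Longrightarrow> u \<in> {0..r1} \<Longrightarrow> v \<in> {0..r2} \<Longrightarrow> g_low x \<le> g x u v"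
    and g_low_pos: "0 < (SUP x\<in>closure \<Omega>. LINT y:\<Omega>|lborel. k x y * g_low y)"
  shows "\<exists>lam1 lam2. \<exists>u0\<in>nonneg_cone (closure \<Omega>). \<exists>v0\<in>nonneg_cone (closure \<Omega>).
           0 < lam1 \<and> 0 < lam2 \<and>
           max_norm (closure \<Omega>) u0 = r1 \<and> max_norm (closure \<Omega>) v0 = r2 \<and>
           (\<forall>x\<in>closure \<Omega>.
              u0 x = lam1 * (LINT y:\<Omega>|lborel. k x y * f y (u0 y) (v0 y)) \<and>
              v0 x = lam2 * (LINT y:\<Omega>|lborel. k x y * g y (u0 y) (v0 y)))"
proof -
  let ?p = "closest_point (cball (0::'a) 1)"
  have cl: "closure \<Omega> = cball 0 1" using \<Omega> by simp
  have kb: "dirichlet_green_function (ball 0 1) k" using k \<Omega> by simp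
  have p: "?p x \<in> cball 0 1" "?p (?p x) = ?p x" for x
    using ball.proj_in[of x] closest_point_self by blast+
  \<comment> \<open>The fixed point stays between 0 and the radii, so the nonlinearities matter only
    on a compact box.\<close>
  have f: "continuous_on (cball 0 1 \<times> {0..r1} \<times> {0..r2}) (\<lambda>(x, u, v). f x u v)"
    by (rule continuous_on_subset[OF f_cont[unfolded cl]]) auto
  have g: "continuous_on (cball 0 1 \<times> {0..r1} \<times> {0..r2}) (\<lambda>(x, u, v). g x u v)"
    by (rule continuous_on_subset[OF g_cont[unfolded cl]]) auto
  obtain f' a where f': "\<And>x. apply_bcontfun f' x = f_low (?p x)" "0 < apply_bcontfun (ball.integral_op f') a"
    using green_potential_pos_point[OF kb f_low_cont[unfolded cl]] f_low_pos \<Omega> cl by metis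
  obtain g' b where g': "\<And>x. apply_bcontfun g' x = g_low (?p x)" "0 < apply_bcontfun (ball.integral_op g') b"
    using green_potential_pos_point[OF kb g_low_cont[unfolded cl]] g_low_pos \<Omega> cl by metis
  obtain u v lam1 lam2 where uv: "u \<in> order_interval r1" "v \<in> order_interval r2"
      "norm u = r1" "norm v = r2" and lam: "0 < lam1" "0 < lam2"
    and u: "u = lam1 *\<^sub>R ball.integral_op (ball.superposition f (u, v))"
    and v: "v = lam2 *\<^sub>R ball.integral_op (ball.superposition g (u, v))"
  proof (rule ball.normalized_eigenpair[OF r f g, of f' g' a b])
    fix x s t assume "x \<in> cball (0::'a) 1" "s \<in> {0..r1}" "t \<in> {0..r2}"
    then show "apply_bcontfun f' x \<le> f x s t" "apply_bcontfun g' x \<le> g x s t" "0 \<le> f x s t" "0 \<le> g x s t"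
      using f_lower g_lower f_nonneg g_nonneg by (simp_all add: f' g' cl closest_point_self)
  qed (use f' g' p in auto)
  have w: "(u, v) \<in> order_interval r1 \<times> order_interval r2" using uv by simp
  \<comment> \<open>\<open>u\<close> is a multiple of a value of \<open>integral_op\<close>, hence
    invariant under the idempotent projection; this is what identifies its norm with the maximum
    over the ball.\<close>
  have up: "apply_bcontfun u x = apply_bcontfun u (?p x)" for x
    by (subst (1 2) u) (simp add: p)
  have vp: "apply_bcontfun v x = apply_bcontfun v (?p x)" for x
    by (subst (1 2) v) (simp add: p)
  have eq: "apply_bcontfun u x = lam1 * (LINT y:ball 0 1|lborel. k x y * f y (apply_bcontfun u y) (apply_bcontfun v y))"
    "apply_bcontfun v x = lam2 * (LINT y:ball 0 1|lborel. k x y * g y (apply_bcontfun u y) (apply_bcontfun v y))"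
    if x: "x \<in> cball 0 1" for x
  proof -
    have "(LINT y:ball 0 1|lborel. k x y * f y (apply_bcontfun u y) (apply_bcontfun v y)) =
       apply_bcontfun (ball.integral_op (ball.superposition f (u, v))) x"
      using kb x by (rule green_potential_eq) (simp add: ball.superposition_apply[OF f w] closest_point_self)
    then show "apply_bcontfun u x = lam1 * (LINT y:ball 0 1|lborel. k x y * f y (apply_bcontfun u y) (apply_bcontfun v y))"
      using arg_cong[OF u, of "\<lambda>u. apply_bcontfun u x"] by (simp del: ball.integral_op_apply)
    have "(LINT y:ball 0 1|lborel. k x y * g y (apply_bcontfun u y) (apply_bcontfun v y)) =
       apply_bcontfun (ball.integral_op (ball.superposition g (u, v))) x"
      using kb x by (rule green_potential_eq) (simp add: ball.superposition_apply[OF g w] closest_point_self)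
    then show "apply_bcontfun v x = lam2 * (LINT y:ball 0 1|lborel. k x y * g y (apply_bcontfun u y) (apply_bcontfun v y))"
      using arg_cong[OF v, of "\<lambda>v. apply_bcontfun v x"] by (simp del: ball.integral_op_apply)
  qed
  have cone: "apply_bcontfun u \<in> nonneg_cone (closure \<Omega>)" "apply_bcontfun v \<in> nonneg_cone (closure \<Omega>)"
    using uv by (auto simp: nonneg_cone_def order_interval_def)
  have "max_norm (closure \<Omega>) (apply_bcontfun u) = r1" "max_norm (closure \<Omega>) (apply_bcontfun v) = r2"
    unfolding cl using max_norm_eq_norm[of ?p "cball 0 1" u] max_norm_eq_norm[of ?p "cball 0 1" v] p up vp uv by auto
  with cone lam eq show ?thesis
    unfolding cl unfolding \<Omega> by blast
qed

end
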